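(* There exist universal constants $C,c,c_0>0$ such that the following holds. Let $\varepsilon\in(0,1)$, let $n\ge c_0/\varepsilon^3$, and let $P=\{e_1,\dots,e_n\}\subset\mathbb{R}^n$ be the standard basis vectors. Let $G\in\mathbb{R}^{t\times n}$ be a Gaussian JL map with $$\frac{C\log(1/\varepsilon)}{\varepsilon^2}\le t\le\frac{\log n}{C\log(1/\varepsilon)}.$$ Then with probability at least $1-\exp(-c\,n\varepsilon^3)-n^{-25}$, $$\operatorname{opt}_{\mathrm{max\text{-}tsp}}(G(P))\ge(\sqrt2-\varepsilon)\cdot\operatorname{opt}_{\mathrm{max\text{-}tsp}}(P).$$
   Context: Norms are Euclidean. A Gaussian JL map is a random $t\times n$ matrix $G$ with i.i.d. $\mathcal{N}(0,1/t)$ entries, and $G(P)=\{Gp:p\in P\}$. For a finite point set $Q$, $\operatorname{opt}_{\mathrm{max\text{-}tsp}}(Q)$ is the maximum of $\sum_{\{p,q\}\in T}\|p-q\|$ over all Hamiltonian cycles $T$ on $Q$. *)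

theory Defs
  imports "HOL-Probability.Probability"
begin

text \<open>Points of R^k are represented as functions nat => real; only coordinates i < k matter.\<close>

definition euclid_dist :: "nat \<Rightarrow> (nat \<Rightarrow> real) \<Rightarrow> (nat \<Rightarrow> real) \<Rightarrow> real" where
  "euclid_dist k x y = sqrt (\<Sum>i<k. (x i - y i)^2)"

definition cycle_cost :: "('a \<Rightarrow> 'a \<Rightarrow> real) \<Rightarrow> 'a list \<Rightarrow> real" where
  "cycle_cost d xs = (\<Sum>i<length xs. d (xs ! i) (xs ! ((i + 1) mod length xs)))"

definition opt_max_tsp :: "('a \<Rightarrow> 'a \<Rightarrow> real) \<Rightarrow> 'a set \<Rightarrow> real" where
  "opt_max_tsp d Q = Max {cycle_cost d xs | xs. distinct xs \<and> set xs = Q}"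

definition std_basis :: "nat \<Rightarrow> (nat \<Rightarrow> real) set" where
  "std_basis n = {(\<lambda>i. if i = j then 1 else 0) | j. j < n}"

definition gauss_JL :: "nat \<Rightarrow> nat \<Rightarrow> (nat \<times> nat \<Rightarrow> real) measure" where
  "gauss_JL t n = PiM ({..<t} \<times> {..<n}) (\<lambda>_. density lborel (normal_density 0 (1 / sqrt (real t))))"

text \<open>Image G(P) of the standard basis: G e_j is the j-th column of G, a point of R^t.\<close>
definition JL_image :: "nat \<Rightarrow> nat \<Rightarrow> (nat \<times> nat \<Rightarrow> real) \<Rightarrow> (nat \<Rightarrow> real) set" where
  "JL_image t n G = {(\<lambda>i. if i < t then G (i, j) else 0) | j. j < n}"

end

theory Submission
  imports Defs
begin

text \<open>
  Flip the sign of the second half of the columns \<open>g\<^sub>j\<close> of \<open>G\<close> and sort the results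
  \<open>y\<^sub>j\<close> of norm at most 2 into cells of diameter at most \<open>\<delta>\<close>. If \<open>y\<^sub>i\<close> and \<open>y\<^sub>j\<close> come from different
  halves and share a cell, then \<open>\<parallel>g\<^sub>i - g\<^sub>j\<parallel> = \<parallel>y\<^sub>i + y\<^sub>j\<parallel> \<ge> \<parallel>y\<^sub>i\<parallel> + \<parallel>y\<^sub>j\<parallel> - \<delta>\<close>. By the symmetry of the
  Gaussian and Hoeffding's inequality every cell holds almost equally many points of either half, and
  there are only \<open>(O(1/\<delta>))^t = n^o(1)\<close> cells, so the tour that alternates between the halves cell
  by cell costs almost \<open>2 (\<parallel>g\<^sub>1\<parallel> + \<dots> + \<parallel>g\<^sub>n\<parallel>)\<close>. Since the mean norm is at least \<open>1 - 1/t\<close>, this is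
  almost \<open>2 n\<close>, while the unprojected optimum is at most \<open>sqrt 2 * n\<close>.

  When \<open>\<epsilon>\<close> is close to 1 the upper bound on \<open>t\<close> is void and there may be too many cells. Then the fixed
  tour through the columns in their given order is good enough.
\<close>

subsection \<open>Tours that alternate between two halves\<close>

text \<open>The closing edge of the cycle is left out. Distances are nonnegative, so a lower bound
  for the open path suffices, and the open path recurses along the list.\<close>

fun path_cost :: "('a \<Rightarrow> 'a \<Rightarrow> real) \<Rightarrow> 'a list \<Rightarrow> real" where
  "path_cost d (x # y # xs) = d x y + path_cost d (y # xs)"
| "path_cost d _ = 0"

text \<open>Counts the edges for which no better bound than 0 is available. \<open>R\<close> will
  say that a distance is nearly the sum of the two norms.\<close>

fun jumps :: "('a \<Rightarrow> 'a \<Rightarrow> bool) \<Rightarrow> 'a list \<Rightarrow> nat" where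
  "jumps R (x # y # xs) = (if R x y then 0 else 1) + jumps R (y # xs)"
| "jumps R _ = 0"

lemma path_cost_eq_sum:
  "path_cost d xs = (\<Sum>i<length xs - 1. d (xs ! i) (xs ! Suc i))"
proof (induction d xs rule: path_cost.induct)
  case (1 d x y xs)
  then show ?case by (simp add: sum.lessThan_Suc_shift del: sum.lessThan_Suc)
qed auto

lemma path_cost_le_cycle_cost:
  assumes "\<And>x y. d x y \<ge> 0"
  shows "path_cost d xs \<le> cycle_cost d xs"
proof (cases "length xs")
  case 0
  then show ?thesis by (simp add: cycle_cost_def path_cost_eq_sum)
next
  case (Suc m)
  have "cycle_cost d xs = (\<Sum>i<m. d (xs ! i) (xs ! ((i + 1) mod length xs))) + d (xs ! m) (xs ! 0)"
    by (simp add: cycle_cost_def Suc)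
  also have "(\<Sum>i<m. d (xs ! i) (xs ! ((i + 1) mod length xs))) = (\<Sum>i<m. d (xs ! i) (xs ! Suc i))"
    by (intro sum.cong) (auto simp: Suc)
  finally show ?thesis using assms by (simp add: path_cost_eq_sum Suc)
qed

lemma cycle_cost_map: "cycle_cost d (map f xs) = cycle_cost (\<lambda>x y. d (f x) (f y)) xs"
  unfolding cycle_cost_def length_map
  by (intro sum.cong refl) (metis length_pos_if_in_set lessThan_iff mod_less_divisor nth_map nth_mem)

text \<open>The 1 pays for the edge across the seam.\<close>

lemma jumps_append: "jumps R (xs @ ys) \<le> jumps R xs + jumps R ys + 1"
proof (induction R xs rule: jumps.induct)
  case ("2_2" R v)
  then show ?case by (cases ys) auto
qed auto

lemma jumps_le_length: "jumps R xs \<le> length xs - 1"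
  by (induction R xs rule: jumps.induct) auto

lemma set_splice: "set (splice xs ys) = set xs \<union> set ys"
  by (induction xs ys rule: splice.induct) auto

lemma distinct_splice: "distinct (splice xs ys) \<longleftrightarrow> distinct (xs @ ys)"
  by (induction xs ys rule: splice.induct) (auto simp: set_splice)

text \<open>Edges are good while the lists alternate, so only the leftover of the longer list jumps;
  at most one of the truncated differences is nonzero. The asymmetric form suits the recursion:
  \<open>splice\<close> swaps its arguments after taking \<open>x\<close>, and the bound for the
  rest is the same number.\<close>

lemma jumps_splice:
  assumes "\<And>x y. x \<in> set xs \<Longrightarrow> y \<in> set ys \<Longrightarrow> R x y \<and> R y x"
  shows "jumps R (splice xs ys) \<le> (length xs - length ys - 1) + (length ys - length xs)"
  using assms
proof (induction xs ys rule: splice.induct)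
  case (1 ys)
  then show ?case using jumps_le_length[of R ys] by simp
next
  case (2 x xs ys)
  show ?case
  proof (cases ys)
    case Nil
    then show ?thesis using jumps_le_length[of R "x # xs"] by simp
  next
    case (Cons y ys')
    have "jumps R (splice ys xs) \<le> (length ys - length xs - 1) + (length xs - length ys)"
      using 2 by auto
    moreover have "R x y" using 2 Cons by auto
    ultimately show ?thesis using Cons by simp
  qed
qed

text \<open>Each vertex collects \<open>f\<close> from both of its edges, hence the factor 2. A jump
  forfeits at most 2 + 2, and so do the two ends of the path, where one edge is missing.\<close>

lemma path_cost_lower_bound:
  assumes d: "\<And>x y. d x y \<ge> 0" and f: "\<And>x. 0 \<le> f x" "\<And>x. f x \<le> 2"
    and R: "\<And>x y. R x y \<Longrightarrow> d x y \<ge> f x + f y - \<delta>" and "\<delta> \<ge> 0"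
  shows "path_cost d xs \<ge> 2 * sum_list (map f xs) - \<delta> * length xs - 4 * jumps R xs - 4"
proof -
  \<comment> \<open>Strengthened for the induction: the first vertex is charged exactly
    \<open>f x\<close>, so that prepending an edge only compares \<open>d x y\<close> with
    \<open>f x + f y\<close>. The last vertex is charged the bound 2.\<close>
  have "path_cost d (x # xs)
      \<ge> 2 * sum_list (map f (x # xs)) - f x - 2 - \<delta> * length (x # xs) - 4 * jumps R (x # xs)" for x xs
  proof (induction xs arbitrary: x)
    case Nil
    then show ?case using f(1,2)[of x] \<open>\<delta> \<ge> 0\<close> by simp
  next
    case (Cons y xs)
    show ?case
      using Cons[of y] R[of x y] d[of x y] f(1,2)[of x] f(1,2)[of y] \<open>\<delta> \<ge> 0\<close>
      by (auto simp: algebra_simps)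
  qed
  note * = this
  show ?thesis
  proof (cases xs)
    case (Cons x ys)
    then show ?thesis using *[of x ys] f(2)[of x] by simp
  qed simp
qed

text \<open>Cells are visited one after the other, and inside a cell the two halves are interleaved.
  The leftover of a cell costs its imbalance in jumps; 1 more is charged for the passage to the next
  cell.\<close>

lemma ex_list_few_jumps:
  fixes key :: "nat \<Rightarrow> 'k"
  assumes K: "finite K" "key ` {..<n} \<subseteq> K" and "h \<le> n"
    and R: "\<And>x y. x < h \<Longrightarrow> h \<le> y \<Longrightarrow> y < n \<Longrightarrow> key x = key y \<Longrightarrow> R x y \<and> R y x"
  obtains xs where "distinct xs" "set xs = {..<n}"
    "real (jumps R xs) \<le>
      (\<Sum>k\<in>K. \<bar>real (card {x. x < h \<and> key x = k}) - real (card {y. h \<le> y \<and> y < n \<and> key y = k})\<bar> + 1)"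
proof -
  define A where "A k = filter (\<lambda>x. key x = k) [0..<h]" for k
  define B where "B k = filter (\<lambda>x. key x = k) [h..<n]" for k
  define L where "L ks = concat (map (\<lambda>k. splice (A k) (B k)) ks)" for ks
  define D where "D k = \<bar>real (card {x. x < h \<and> key x = k}) - real (card {y. h \<le> y \<and> y < n \<and> key y = k})\<bar>" for k
  have lA: "length (A k) = card {x. x < h \<and> key x = k}" for k
    unfolding A_def distinct_card[OF distinct_filter[OF distinct_upt], symmetric]
    by (intro arg_cong[of _ _ card]) auto
  have lB: "length (B k) = card {y. h \<le> y \<and> y < n \<and> key y = k}" for k
    unfolding B_def distinct_card[OF distinct_filter[OF distinct_upt], symmetric]
    by (intro arg_cong[of _ _ card]) auto
  have jump1: "real (jumps R (splice (A k) (B k))) \<le> D k" for k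
  proof -
    have "jumps R (splice (A k) (B k)) \<le> (length (A k) - length (B k) - 1) + (length (B k) - length (A k))"
      by (rule jumps_splice) (use R in \<open>auto simp: A_def B_def\<close>)
    then show ?thesis unfolding D_def lA lB by linarith
  qed
  obtain ks where ks: "set ks = K" "distinct ks" using finite_distinct_list[OF K(1)] by blast
  have jumps: "real (jumps R (L ks)) \<le> (\<Sum>k\<leftarrow>ks. D k + 1)" for ks
  proof (induction ks)
    case (Cons k ks)
    have "jumps R (L (k # ks)) \<le> jumps R (splice (A k) (B k)) + jumps R (L ks) + 1"
      using jumps_append[of R "splice (A k) (B k)" "L ks"] by (simp add: L_def)
    then show ?case using Cons jump1[of k] by simp
  qed (simp add: L_def)
  have setL: "set (L ks) = {x. x < n \<and> key x \<in> set ks}" for ks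
    using \<open>h \<le> n\<close> by (auto simp: L_def A_def B_def set_splice)
  have distL: "distinct (L ks)" if "distinct ks" for ks
    using that
  proof (induction ks)
    case (Cons k ks)
    have "distinct (splice (A k) (B k))" by (auto simp: A_def B_def distinct_splice)
    moreover have "set (splice (A k) (B k)) \<inter> set (L ks) = {}"
      using Cons.prems by (auto simp: setL set_splice A_def B_def)
    ultimately show ?case using Cons by (auto simp: L_def)
  qed (simp add: L_def)
  show thesis
  proof
    show "distinct (L ks)" by (rule distL) fact
    show "set (L ks) = {..<n}" using K ks by (auto simp: setL)
    show "real (jumps R (L ks)) \<le> (\<Sum>k\<in>K. \<bar>real (card {x. x < h \<and> key x = k})
        - real (card {y. h \<le> y \<and> y < n \<and> key y = k})\<bar> + 1)"
      using jumps[of ks] ks by (simp add: D_def sum_list_distinct_conv_sum_set)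
  qed
qed

section \<open>From the optimum to single tours; the standard basis\<close>

text \<open>\<open>Max\<close> is informative only on a finite nonempty set; finiteness comes from
  the bounded length of duplicate-free lists over \<open>Q\<close>.\<close>

lemma le_opt_max_tsp_iff:
  assumes "finite Q"
  shows "r \<le> opt_max_tsp d Q \<longleftrightarrow> (\<exists>xs. distinct xs \<and> set xs = Q \<and> r \<le> cycle_cost d xs)"
proof -
  let ?S = "{cycle_cost d xs | xs. distinct xs \<and> set xs = Q}"
  have "{xs. distinct xs \<and> set xs = Q} \<subseteq> {xs. set xs \<subseteq> Q \<and> length xs \<le> card Q}"
    by (auto simp: distinct_card)
  then have "finite {xs. distinct xs \<and> set xs = Q}"
    using finite_lists_length_le[OF assms] finite_subset by blast
  then have "finite ?S" by simp
  moreover have "?S \<noteq> {}" using finite_distinct_list[OF assms] by blast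
  ultimately show ?thesis unfolding opt_max_tsp_def by (subst Max_ge_iff) auto
qed

lemma opt_max_tsp_std_basis_le: "opt_max_tsp (euclid_dist n) (std_basis n) \<le> n * sqrt 2"
proof -
  have fin: "finite (std_basis n)" unfolding std_basis_def by simp
  obtain xs where xs: "distinct xs" "set xs = std_basis n"
    and opt: "opt_max_tsp (euclid_dist n) (std_basis n) \<le> cycle_cost (euclid_dist n) xs"
    using le_opt_max_tsp_iff[OF fin, THEN iffD1, OF order_refl] by blast
  have d: "euclid_dist n p q \<le> sqrt 2" if pq: "p \<in> std_basis n" "q \<in> std_basis n" for p q
  proof -
    obtain a b where ab: "a < n" "b < n" "p = (\<lambda>i. if i = a then 1 else 0)" "q = (\<lambda>i. if i = b then 1 else 0)"
      using pq unfolding std_basis_def by blast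
    \<comment> \<open>Comparison with a sum of two indicators covers \<open>a = b\<close> as
      well.\<close>
    have "(\<Sum>i<n. (p i - q i)\<^sup>2) \<le> (\<Sum>i<n. (if i = a then 1 else 0) + (if i = b then 1 else 0))"
      by (intro sum_mono) (auto simp: ab)
    also have "\<dots> = 2" using ab by (simp add: sum.distrib)
    finally show ?thesis by (simp add: euclid_dist_def)
  qed
  have "card (std_basis n) \<le> n"
    using card_image_le[of "{..<n}" "\<lambda>j i. if i = j then 1 else (0::real)"]
    unfolding std_basis_def by (simp add: setcompr_eq_image lessThan_def)
  then have len: "length xs \<le> n" using xs distinct_card by metis
  have "cycle_cost (euclid_dist n) xs \<le> (\<Sum>i<length xs. sqrt 2)"
    unfolding cycle_cost_def
  proof (intro sum_mono d)
    fix i assume "i \<in> {..<length xs}"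
    then have "i < length xs" "(i + 1) mod length xs < length xs"
      by (auto intro!: mod_less_divisor)
    then show "xs ! i \<in> std_basis n" "xs ! ((i + 1) mod length xs) \<in> std_basis n"
      using xs(2) nth_mem by blast+
  qed
  also have "\<dots> \<le> n * sqrt 2" using len by simp
  finally show ?thesis using opt by simp
qed

subsection \<open>Moments and independence of Gaussian columns\<close>

text \<open>The quadratic touches the root at \<open>u = s\<^sup>2\<close>; it reduces a lower bound for a mean norm to second
  and fourth moments.\<close>
lemma sqrt_ge_quadratic:
  fixes u s :: real
  assumes "u \<ge> 0" "s > 0"
  shows "(3 * u / s - u\<^sup>2 / s ^ 3) / 2 \<le> sqrt u"
proof -
  define r where "r = sqrt u"
  have r: "r \<ge> 0" "u = r\<^sup>2" using assms by (auto simp: r_def)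
  have "r * (r - s)\<^sup>2 * (r + 2 * s) / s ^ 3 \<ge> 0" using r assms by simp
  also have "r * (r - s)\<^sup>2 * (r + 2 * s) / s ^ 3 = 2 * r - (3 * u / s - u\<^sup>2 / s ^ 3)"
    using assms unfolding r by (simp add: field_simps power2_eq_square power3_eq_cube)
  finally show ?thesis unfolding r_def by simp
qed

context prob_space
begin

lemma normal_moments:
  assumes X: "distributed M lborel X (normal_density 0 \<sigma>)" and \<sigma>: "\<sigma> > 0"
  shows "integrable M (\<lambda>x. X x ^ k)"
    and "expectation (\<lambda>x. X x ^ 2) = \<sigma>\<^sup>2" "expectation (\<lambda>x. X x ^ 4) = 3 * \<sigma> ^ 4"
    and "AE x in M. X x \<noteq> 0"
proof -
  have [measurable]: "X \<in> borel_measurable M" using distributed_measurable[OF X] by simp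
  show "integrable M (\<lambda>x. X x ^ k)"
    using distributed_integrable[OF X, of "\<lambda>x. x ^ k"] integrable_normal_moment[OF \<sigma>, of 0 k] by simp
  have m: "expectation (\<lambda>x. X x ^ k) = (\<integral>x. normal_density 0 \<sigma> x * x ^ k \<partial>lborel)" for k
    using distributed_integral[OF X, of "\<lambda>x. x ^ k"] by simp
  show "expectation (\<lambda>x. X x ^ 2) = \<sigma>\<^sup>2"
    using integral_normal_moment_even[OF \<sigma>, of 0 1] m[of 2] by simp
  show "expectation (\<lambda>x. X x ^ 4) = 3 * \<sigma> ^ 4"
    using integral_normal_moment_even[OF \<sigma>, of 0 2] m[of 4]
    by (simp add: fact_numeral power2_eq_square power4_eq_xxxx)
  \<comment> \<open>A law with a density gives no mass to a point; this later makes the columns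
    distinct almost surely.\<close>
  have "AE x in lborel. x \<noteq> (0::real)" by (rule AE_lborel_singleton)
  then have "AE x in density lborel (normal_density 0 \<sigma>). x \<noteq> 0"
    by (subst AE_density) (auto elim: eventually_mono)
  then have "AE x in distr M lborel X. x \<noteq> 0"
    unfolding distributed_distr_eq_density[OF X] .
  then show "AE x in M. X x \<noteq> 0" by (subst (asm) AE_distr_iff) auto
qed

text \<open>Up to scaling, the first two moments of a chi-square variable. The new square is
  independent of the partial sum, so the cross term factors; integrability is carried through the
  induction because the factorization needs it.\<close>

lemma sum_squares_normal:
  fixes \<sigma> :: real
  assumes "finite I" and ind: "indep_vars (\<lambda>_. borel) X I" and \<sigma>: "\<sigma> > 0"
    and X: "\<And>i. i \<in> I \<Longrightarrow> distributed M lborel (X i) (normal_density 0 \<sigma>)"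
  shows "integrable M (\<lambda>x. \<Sum>i\<in>I. (X i x)\<^sup>2) \<and> integrable M (\<lambda>x. (\<Sum>i\<in>I. (X i x)\<^sup>2)\<^sup>2) \<and>
    expectation (\<lambda>x. \<Sum>i\<in>I. (X i x)\<^sup>2) = card I * \<sigma>\<^sup>2 \<and>
    expectation (\<lambda>x. (\<Sum>i\<in>I. (X i x)\<^sup>2)\<^sup>2) = ((card I)\<^sup>2 + 2 * card I) * \<sigma> ^ 4"
  using assms(1) ind X
proof (induction I rule: finite_induct)
  case empty
  then show ?case by simp
next
  case (insert i I)
  let ?U = "\<lambda>x. \<Sum>i\<in>I. (X i x)\<^sup>2" and ?Y = "\<lambda>x. (X i x)\<^sup>2"
  have IH: "integrable M ?U" "integrable M (\<lambda>x. (?U x)\<^sup>2)" "expectation ?U = card I * \<sigma>\<^sup>2"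
    "expectation (\<lambda>x. (?U x)\<^sup>2) = ((card I)\<^sup>2 + 2 * card I) * \<sigma> ^ 4"
    using insert.IH insert.prems indep_vars_subset by (metis insertCI subset_insertI)+
  have Xi: "distributed M lborel (X i) (normal_density 0 \<sigma>)" using insert.prems by simp
  note Y = normal_moments[OF Xi \<sigma>]
  have Y4: "(\<lambda>x. (?Y x)\<^sup>2) = (\<lambda>x. X i x ^ 4)" by (simp add: power_mult[symmetric])
  have "indep_vars (\<lambda>_. borel) (\<lambda>i x. (X i x)\<^sup>2) (insert i I)"
    by (rule indep_vars_compose2[OF insert.prems(1)]) auto
  then have ind: "indep_var borel ?Y borel ?U"
    by (rule indep_vars_sum[OF insert.hyps])
  have YU: "integrable M (\<lambda>x. ?Y x * ?U x)" "expectation (\<lambda>x. ?Y x * ?U x) = expectation ?Y * expectation ?U"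
    by (rule indep_var_integrable[OF ind Y(1) IH(1)], rule indep_var_lebesgue_integral[OF ind Y(1) IH(1)])
  have eq: "(\<lambda>x. (\<Sum>i\<in>insert i I. (X i x)\<^sup>2)\<^sup>2) = (\<lambda>x. X i x ^ 4 + 2 * (?Y x * ?U x) + (?U x)\<^sup>2)"
    using insert.hyps by (auto simp: power2_sum power_mult[symmetric] algebra_simps fun_eq_iff)
  have "integrable M (\<lambda>x. 2 * (?Y x * ?U x))" using YU(1) by (rule integrable_mult_right)
  then have "expectation (\<lambda>x. (\<Sum>i\<in>insert i I. (X i x)\<^sup>2)\<^sup>2)
      = 3 * \<sigma> ^ 4 + 2 * (\<sigma>\<^sup>2 * (card I * \<sigma>\<^sup>2)) + ((card I)\<^sup>2 + 2 * card I) * \<sigma> ^ 4"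
    "integrable M (\<lambda>x. (\<Sum>i\<in>insert i I. (X i x)\<^sup>2)\<^sup>2)"
    unfolding eq using IH Y(1)[of 4] Y(3) YU Y(2) by simp_all
  moreover have "3 * \<sigma> ^ 4 + 2 * (\<sigma>\<^sup>2 * (card I * \<sigma>\<^sup>2)) + ((card I)\<^sup>2 + 2 * card I) * \<sigma> ^ 4
      = ((card (insert i I))\<^sup>2 + 2 * card (insert i I)) * \<sigma> ^ 4"
    using insert.hyps by (simp add: algebra_simps power2_eq_square power4_eq_xxxx)
  ultimately show ?case
    using insert.hyps IH Y(1)[of 2] Y(2) by (simp add: algebra_simps)
qed

text \<open>Jensen's inequality bounds the mean of a square root only from above; a quadratic
  minorant bounds it from below. A general \<open>f\<close> in place of the root admits truncated
  norms.\<close>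

lemma expectation_ge_quadratic:
  fixes U f :: "'a \<Rightarrow> real"
  assumes U: "integrable M U" "integrable M (\<lambda>x. (U x)\<^sup>2)" and f: "integrable M f"
    and le: "\<And>x. x \<in> space M \<Longrightarrow> (3 * U x / s - (U x)\<^sup>2 / s ^ 3) / 2 \<le> f x"
  shows "(3 * expectation U / s - expectation (\<lambda>x. (U x)\<^sup>2) / s ^ 3) / 2 \<le> expectation f"
proof -
  have "expectation (\<lambda>x. (3 * U x / s - (U x)\<^sup>2 / s ^ 3) / 2) \<le> expectation f"
    using U f le by (intro integral_mono) auto
  then show ?thesis using U by simp
qed

end

section \<open>Signed columns of the Gaussian matrix\<close>

abbreviation gaussN :: "nat \<Rightarrow> real measure" where
  "gaussN t \<equiv> density lborel (normal_density 0 (1 / sqrt (real t)))"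

text \<open>\<open>s\<close> will be a sign. The function is extensional so as to be a point of
  \<open>vecM t\<close>.\<close>

definition column :: "nat \<Rightarrow> real \<Rightarrow> nat \<Rightarrow> (nat \<times> nat \<Rightarrow> real) \<Rightarrow> nat \<Rightarrow> real" where
  "column t s j G = (\<lambda>i\<in>{..<t}. s * G (i, j))"

abbreviation vecM :: "nat \<Rightarrow> (nat \<Rightarrow> real) measure" where
  "vecM t \<equiv> PiM {..<t} (\<lambda>_. borel)"

lemma prob_space_gaussN: "t > 0 \<Longrightarrow> prob_space (gaussN t)"
  by (rule prob_space_normal_density) simp

lemma sets_gauss_JL: "sets (gauss_JL t n) = sets (PiM ({..<t} \<times> {..<n}) (\<lambda>_. borel))"
  unfolding gauss_JL_def by (intro sets_PiM_cong) auto

lemma measurable_gauss_JL_component [measurable]: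
  "p \<in> {..<t} \<times> {..<n} \<Longrightarrow> (\<lambda>G. G p) \<in> borel_measurable (gauss_JL t n)"
  unfolding measurable_cong_sets[OF sets_gauss_JL refl] by simp

lemma measurable_column:
  "j < n \<Longrightarrow> column t s j \<in> measurable (gauss_JL t n) (vecM t)"
  unfolding column_def by (intro measurable_restrict borel_measurable_times measurable_gauss_JL_component) auto

context
  fixes t n :: nat
  assumes t: "t > 0"
begin

lemma prob_space_gauss_JL: "prob_space (gauss_JL t n)"
  unfolding gauss_JL_def by (intro prob_space_PiM prob_space_gaussN t)

interpretation prob_space "gauss_JL t n" by (rule prob_space_gauss_JL)

lemma distributed_gauss_JL_component:
  assumes "p \<in> {..<t} \<times> {..<n}"
  shows "distributed (gauss_JL t n) lborel (\<lambda>G. G p) (normal_density 0 (1 / sqrt t))"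
proof -
  have "distr (gauss_JL t n) (gaussN t) (\<lambda>G. G p) = gaussN t"
    unfolding gauss_JL_def by (rule distr_PiM_component) (use assms prob_space_gaussN t in auto)
  then have "distr (gauss_JL t n) lborel (\<lambda>G. G p) = gaussN t"
    by (metis (no_types, lifting) distr_cong sets_density)
  then show ?thesis
    unfolding distributed_def using assms by (auto intro!: measurable_gauss_JL_component)
qed

text \<open>The law of the matrix is by construction the product of the laws of its entries, which
  characterizes independence.\<close>

lemma indep_gauss_JL_components:
  "indep_vars (\<lambda>_. borel) (\<lambda>p G. G p) ({..<t} \<times> {..<n})"
\<comment> \<open>That characterization asks for a nonempty index set.\<close>
proof (cases "n = 0")
  case True
  then have "{..<t} \<times> {..<n} = {}" by simp
  then show ?thesis by (simp only: indep_vars_def indep_sets_def) auto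
next
  case False
  let ?I = "{..<t} \<times> {..<n}"
  show ?thesis
  proof (subst indep_vars_iff_distr_eq_PiM')
    show "?I \<noteq> {}" using False t by auto
    have "distr (gauss_JL t n) (PiM ?I (\<lambda>_. borel)) (\<lambda>G. \<lambda>p\<in>?I. G p) = distr (gauss_JL t n) (gauss_JL t n) (\<lambda>G. G)"
    proof (rule distr_cong)
      show "sets (PiM ?I (\<lambda>_. borel)) = sets (gauss_JL t n)" by (simp only: sets_gauss_JL)
      show "(\<lambda>p\<in>?I. G p) = G" if "G \<in> space (gauss_JL t n)" for G
        using that by (auto simp: gauss_JL_def space_PiM)
    qed simp
    also have "\<dots> = gauss_JL t n" by (rule distr_id)
    also have "\<dots> = PiM ?I (\<lambda>_. gaussN t)" by (simp only: gauss_JL_def)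
    also have "\<dots> = PiM ?I (\<lambda>p. distr (gauss_JL t n) borel (\<lambda>G. G p))"
    proof (intro PiM_cong refl)
      fix p assume "p \<in> ?I"
      have "distr (gauss_JL t n) borel (\<lambda>G. G p) = distr (gauss_JL t n) lborel (\<lambda>G. G p)"
        by (intro distr_cong) auto
      then show "gaussN t = distr (gauss_JL t n) borel (\<lambda>G. G p)"
        using distributed_distr_eq_density[OF distributed_gauss_JL_component[OF \<open>p \<in> ?I\<close>]] by simp
    qed
    finally show "distr (gauss_JL t n) (PiM ?I (\<lambda>_. borel)) (\<lambda>G. \<lambda>p\<in>?I. G p)
      = PiM ?I (\<lambda>p. distr (gauss_JL t n) borel (\<lambda>G. G p))" .
  qed auto
qed

text \<open>Different columns read disjoint blocks of entries.\<close>

lemma indep_columns: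
  "indep_vars (\<lambda>_. vecM t) (\<lambda>j. column t (s j) j) {..<n}"
proof -
  let ?K = "\<lambda>j. {..<t} \<times> {j}"
  have "indep_vars (\<lambda>j. PiM (?K j) (\<lambda>_. borel)) (\<lambda>j G. restrict (\<lambda>p. G p) (?K j)) {..<n}"
    by (rule indep_vars_restrict[OF indep_gauss_JL_components]) (auto simp: disjoint_family_on_def)
  then have "indep_vars (\<lambda>_. vecM t) (\<lambda>j G. column t (s j) j (restrict (\<lambda>p. G p) (?K j))) {..<n}"
    by (rule indep_vars_compose2, unfold column_def, intro measurable_restrict borel_measurable_times) auto
  also have "(\<lambda>j G. column t (s j) j (restrict (\<lambda>p. G p) (?K j))) = (\<lambda>j. column t (s j) j)"
    by (auto simp: column_def fun_eq_iff)
  finally show ?thesis .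
qed

text \<open>A centred Gaussian is invariant under a change of sign. The right-hand side mentions
  neither \<open>s\<close> nor \<open>j\<close>, so flipped and unflipped columns share one
  law.\<close>

lemma distr_column:
  assumes s: "\<bar>s\<bar> = 1" and j: "j < n"
  shows "distr (gauss_JL t n) (vecM t) (column t s j) = PiM {..<t} (\<lambda>_. distr (gaussN t) borel (\<lambda>x. x))"
proof -
  have comp: "distributed (gauss_JL t n) lborel (\<lambda>G. s * G (i, j)) (normal_density 0 (1 / sqrt t))"
    if "i < t" for i
    using normal_density_affine[OF distributed_gauss_JL_component[of "(i, j)"], of s 0] that s j t by auto
  have "indep_vars (\<lambda>i. PiM {(i, j)} (\<lambda>_. borel)) (\<lambda>i G. restrict (\<lambda>p. G p) {(i, j)}) {..<t}"
    by (rule indep_vars_restrict[OF indep_gauss_JL_components]) (use j in \<open>auto simp: disjoint_family_on_def\<close>)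
  then have "indep_vars (\<lambda>_. borel) (\<lambda>i G. s * restrict (\<lambda>p. G p) {(i, j)} (i, j)) {..<t}"
    by (rule indep_vars_compose2) auto
  then have "indep_vars (\<lambda>_. borel) (\<lambda>i G. s * G (i, j)) {..<t}" by simp
  then have "distr (gauss_JL t n) (vecM t) (\<lambda>G. \<lambda>i\<in>{..<t}. s * G (i, j))
      = PiM {..<t} (\<lambda>i. distr (gauss_JL t n) borel (\<lambda>G. s * G (i, j)))"
    by (subst (asm) indep_vars_iff_distr_eq_PiM') (use t j in auto)
  also have "\<dots> = PiM {..<t} (\<lambda>_. distr (gaussN t) borel (\<lambda>x. x))"
  proof (intro PiM_cong refl)
    fix i assume "i \<in> {..<t}"
    have "distr (gauss_JL t n) borel (\<lambda>G. s * G (i, j)) = distr (gauss_JL t n) lborel (\<lambda>G. s * G (i, j))"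
      by (intro distr_cong) auto
    also have "\<dots> = gaussN t"
      using distributed_distr_eq_density[OF comp] \<open>i \<in> {..<t}\<close> by simp
    also have "\<dots> = distr (gaussN t) borel (\<lambda>x. x)"
      by (rule distr_id2[symmetric]) simp
    finally show "distr (gauss_JL t n) borel (\<lambda>G. s * G (i, j)) = distr (gaussN t) borel (\<lambda>x. x)" .
  qed
  finally show ?thesis by (simp add: column_def[abs_def])
qed

lemma expectation_column_eq:
  fixes \<phi> :: "(nat \<Rightarrow> real) \<Rightarrow> real"
  assumes [measurable]: "\<phi> \<in> borel_measurable (vecM t)" and "\<bar>s\<bar> = 1" "\<bar>s'\<bar> = 1" "j < n" "j' < n"
  shows "expectation (\<lambda>G. \<phi> (column t s j G)) = expectation (\<lambda>G. \<phi> (column t s' j' G))"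
proof -
  have "expectation (\<lambda>G. \<phi> (column t s j G)) = (\<integral>y. \<phi> y \<partial>distr (gauss_JL t n) (vecM t) (column t s j))"
    by (rule integral_distr[symmetric]) (use assms measurable_column in auto)
  also have "\<dots> = (\<integral>y. \<phi> y \<partial>distr (gauss_JL t n) (vecM t) (column t s' j'))"
    using assms by (simp add: distr_column)
  also have "\<dots> = expectation (\<lambda>G. \<phi> (column t s' j' G))"
    by (rule integral_distr) (use assms measurable_column in auto)
  finally show ?thesis .
qed

text \<open>The variances of the two independent entries add up to 2/t, and different rows use
  disjoint pairs of entries.\<close>

lemma column_difference_normal:
  assumes "a < n" "b < n" "a \<noteq> b"
  shows "indep_vars (\<lambda>_. borel) (\<lambda>i G. G (i, a) - G (i, b)) {..<t}"
    and "i < t \<Longrightarrow> distributed (gauss_JL t n) lborel (\<lambda>G. G (i, a) - G (i, b)) (normal_density 0 (sqrt (2 / t)))"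
proof -
  have "indep_vars (\<lambda>i. PiM {(i, a), (i, b)} (\<lambda>_. borel)) (\<lambda>i G. restrict (\<lambda>p. G p) {(i, a), (i, b)}) {..<t}"
    by (rule indep_vars_restrict[OF indep_gauss_JL_components]) (use assms in \<open>auto simp: disjoint_family_on_def\<close>)
  then have "indep_vars (\<lambda>_. borel) (\<lambda>i G. restrict (\<lambda>p. G p) {(i, a), (i, b)} (i, a)
      - restrict (\<lambda>p. G p) {(i, a), (i, b)} (i, b)) {..<t}"
    by (rule indep_vars_compose2) auto
  then show "indep_vars (\<lambda>_. borel) (\<lambda>i G. G (i, a) - G (i, b)) {..<t}" by simp
  assume i: "i < t"
  have "indep_vars (\<lambda>_. borel) (\<lambda>p G. G p) (insert (i, a) {(i, b)})"
    by (rule indep_vars_subset[OF indep_gauss_JL_components]) (use i assms in auto)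
  from indep_vars_sum[OF _ _ this] assms
  have "indep_var borel (\<lambda>G. G (i, a)) borel (\<lambda>G. G (i, b))" by simp
  from diff_indep_normal[OF this _ _ distributed_gauss_JL_component distributed_gauss_JL_component]
  show "distributed (gauss_JL t n) lborel (\<lambda>G. G (i, a) - G (i, b)) (normal_density 0 (sqrt (2 / t)))"
    using assms i t by (simp add: power_divide)
qed

end

subsection \<open>The optimum as a random variable\<close>

lemma sqrt_power4: "x \<ge> 0 \<Longrightarrow> sqrt x ^ 4 = x\<^sup>2"
  by (simp add: power4_eq_xxxx power2_eq_square)

definition JL_col :: "nat \<Rightarrow> (nat \<times> nat \<Rightarrow> real) \<Rightarrow> nat \<Rightarrow> nat \<Rightarrow> real" where
  "JL_col t G j = (\<lambda>i. if i < t then G (i, j) else 0)"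

lemma JL_image_eq: "JL_image t n G = JL_col t G ` {..<n}"
  unfolding JL_image_def JL_col_def by auto

lemma euclid_dist_JL_col:
  "euclid_dist t (JL_col t G a) (JL_col t G b) = sqrt (\<Sum>i<t. (G (i, a) - G (i, b))\<^sup>2)"
  unfolding euclid_dist_def JL_col_def by simp

lemma euclid_dist_nonneg: "euclid_dist t x y \<ge> 0"
  unfolding euclid_dist_def by (simp add: sum_nonneg)

lemma JL_col_eq_iff: "JL_col t G a = JL_col t G b \<longleftrightarrow> (\<forall>i<t. G (i, a) = G (i, b))"
  unfolding JL_col_def by (auto simp: fun_eq_iff)

lemma sets_JL_col_eq:
  assumes "a < n" "b < n"
  shows "{G \<in> space (gauss_JL t n). JL_col t G a = JL_col t G b} \<in> sets (gauss_JL t n)"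
proof -
  have "{G \<in> space (gauss_JL t n). \<forall>i\<in>{..<t}. G (i, a) = G (i, b)} \<in> sets (gauss_JL t n)"
    using assms by (intro sets.sets_Collect_finite_All borel_measurable_eq measurable_gauss_JL_component) auto
  then show ?thesis unfolding JL_col_eq_iff lessThan_iff[symmetric] Ball_def .
qed

lemma measurable_dist:
  assumes "a < n" "b < n"
  shows "(\<lambda>G. euclid_dist t (JL_col t G a) (JL_col t G b)) \<in> borel_measurable (gauss_JL t n)"
  unfolding euclid_dist_JL_col using assms
  by (intro measurable_compose[OF _ borel_measurable_sqrt] borel_measurable_sum borel_measurable_power borel_measurable_diff
      measurable_gauss_JL_component) auto

lemma sets_opt_max_tsp_JL:
  "{G \<in> space (gauss_JL t n). r \<le> opt_max_tsp (euclid_dist t) (JL_image t n G)} \<in> sets (gauss_JL t n)"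
proof -
  let ?M = "gauss_JL t n" and ?c = "JL_col t"
  let ?J = "{js. set js \<subseteq> {..<n} \<and> length js \<le> n}"
  let ?E = "\<lambda>js. {G \<in> space ?M. (\<forall>i\<in>{..<length js}. \<forall>k\<in>{..<length js}. i \<noteq> k \<longrightarrow> \<not> ?c G (js ! i) = ?c G (js ! k))
     \<and> (\<forall>a\<in>{..<n}. \<exists>b\<in>set js. ?c G a = ?c G b) \<and> r \<le> cycle_cost (\<lambda>a b. euclid_dist t (?c G a) (?c G b)) js}"
  have eq: "{G \<in> space ?M. r \<le> opt_max_tsp (euclid_dist t) (JL_image t n G)} = (\<Union>js\<in>?J. ?E js)"
  proof (intro set_eqI iffI)
    fix G assume "G \<in> {G \<in> space ?M. r \<le> opt_max_tsp (euclid_dist t) (JL_image t n G)}"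
    then have G: "G \<in> space ?M" "r \<le> opt_max_tsp (euclid_dist t) (?c G ` {..<n})" by (auto simp: JL_image_eq)
    then obtain xs where xs: "distinct xs" "set xs = ?c G ` {..<n}" "r \<le> cycle_cost (euclid_dist t) xs"
      by (subst (asm) le_opt_max_tsp_iff) auto
    \<comment> \<open>One column index is chosen for every point of the tour.\<close>
    define js where "js = map (inv_into {..<n} (?c G)) xs"
    have map: "map (?c G) js = xs" unfolding js_def using xs(2)
      by (auto intro!: map_idI simp: f_inv_into_f)
    have "length xs = card (set xs)" using xs(1) by (simp add: distinct_card)
    also have "\<dots> \<le> n" unfolding xs(2) using card_image_le[of "{..<n}" "?c G"] by simp
    finally have "length xs \<le> n" .
    moreover have "set js \<subseteq> {..<n}"
      unfolding js_def set_map xs(2) by (intro image_subsetI inv_into_into)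
    ultimately have "js \<in> ?J" by (simp add: js_def)
    moreover have "G \<in> ?E js"
    proof -
      have "distinct (map (?c G) js)" "set (map (?c G) js) = ?c G ` {..<n}"
        "r \<le> cycle_cost (euclid_dist t) (map (?c G) js)" using xs map by auto
      then show ?thesis using G(1)
        by (auto simp: distinct_conv_nth cycle_cost_map)
    qed
    ultimately show "G \<in> (\<Union>js\<in>?J. ?E js)" by blast
  next
    fix G assume "G \<in> (\<Union>js\<in>?J. ?E js)"
    then obtain js where js: "js \<in> ?J" "G \<in> ?E js" by blast
    then have "distinct (map (?c G) js)" by (simp add: distinct_conv_nth)
    moreover have "set (map (?c G) js) = ?c G ` {..<n}" using js by auto
    moreover have "r \<le> cycle_cost (euclid_dist t) (map (?c G) js)"
      using js by (simp add: cycle_cost_map)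
    ultimately have "r \<le> opt_max_tsp (euclid_dist t) (?c G ` {..<n})"
      by (subst le_opt_max_tsp_iff) blast+
    then show "G \<in> {G \<in> space ?M. r \<le> opt_max_tsp (euclid_dist t) (JL_image t n G)}"
      using js(2) by (simp add: JL_image_eq)
  qed
  have "finite ?J" by (rule finite_lists_length_le) simp
  moreover have "?E js \<in> sets ?M" if "js \<in> ?J" for js
  proof -
    have nth: "js ! i < n" if "i < length js" for i using \<open>js \<in> ?J\<close> that nth_mem by blast
    have "(\<lambda>G. cycle_cost (\<lambda>a b. euclid_dist t (?c G a) (?c G b)) js) \<in> borel_measurable ?M"
      unfolding cycle_cost_def
    proof (intro borel_measurable_sum measurable_dist nth)
      fix i assume "i \<in> {..<length js}"
      then show "i < length js" "(i + 1) mod length js < length js" by (auto intro!: mod_less_divisor)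
    qed
    then show ?thesis
      using that nth
      by (intro sets.sets_Collect_conj sets.sets_Collect_finite_All sets.sets_Collect_finite_Ex
          sets.sets_Collect_imp sets.sets_Collect_neg sets.sets_Collect_const sets_JL_col_eq
          borel_measurable_le measurable_const) auto
  qed
  ultimately show ?thesis unfolding eq by (rule sets.finite_UN) 
qed

context
  fixes t n :: nat
  assumes t: "t > 0"
begin

interpretation prob_space "gauss_JL t n" by (rule prob_space_gauss_JL[OF t])

text \<open>\<open>JL_image\<close> is a set, so coinciding columns would shorten its tours. The
  first row alone separates the columns almost surely.\<close>

lemma AE_inj_on_JL_col: "AE G in gauss_JL t n. inj_on (JL_col t G) {..<n}"
proof -
  have "AE G in gauss_JL t n. \<forall>a\<in>{..<n}. \<forall>b\<in>{..<n}. a \<noteq> b \<longrightarrow> G (0, a) - G (0, b) \<noteq> 0"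
  proof (intro AE_finite_allI finite_lessThan AE_impI)
    fix a b assume "a \<in> {..<n}" "b \<in> {..<n}" "a \<noteq> b"
    then show "AE G in gauss_JL t n. G (0, a) - G (0, b) \<noteq> 0"
      using t by (intro normal_moments(4)[OF column_difference_normal(2)]) auto
  qed
  then show ?thesis
  proof (rule AE_mp, intro AE_I2 impI)
    fix G :: "nat \<times> nat \<Rightarrow> real"
    assume *: "\<forall>a\<in>{..<n}. \<forall>b\<in>{..<n}. a \<noteq> b \<longrightarrow> G (0, a) - G (0, b) \<noteq> 0"
    show "inj_on (JL_col t G) {..<n}"
      by (rule inj_onI) (use * t in \<open>force simp: JL_col_eq_iff\<close>)
  qed
qed

text \<open>The truncation at 3 prepares for Hoeffding's inequality. The squared distance has mean 2
  and second moment at most 12 for every \<open>t\<close>; for these values the best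
  \<open>s\<close> in the quadratic minorant is \<open>sqrt 6\<close>, and the nearby 5/2 gives
  0.816.\<close>

lemma expectation_dist_ge:
  assumes ab: "a < n" "b < n" "a \<noteq> b"
  shows "expectation (\<lambda>G. min 3 (euclid_dist t (JL_col t G a) (JL_col t G b))) \<ge> 4 / 5"
proof -
  let ?U = "\<lambda>G. \<Sum>i<t. (G (i, a) - G (i, b))\<^sup>2"
  have s4: "sqrt (2 / real t) ^ 4 = 4 / (real t)\<^sup>2"
    by (simp add: sqrt_power4 power_divide)
  note U = sum_squares_normal[OF finite_lessThan column_difference_normal(1)[OF t ab] _
      column_difference_normal(2)[OF t ab], simplified, OF t]
  have "integrable (gauss_JL t n) ?U" "integrable (gauss_JL t n) (\<lambda>G. (?U G)\<^sup>2)" using U by auto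
  moreover have "integrable (gauss_JL t n) (\<lambda>G. min 3 (euclid_dist t (JL_col t G a) (JL_col t G b)))"
    using measurable_dist[of a n b] ab
    by (intro integrable_const_bound[where B=3]) (auto simp: euclid_dist_nonneg)
  moreover have "(3 * ?U G / (5/2) - (?U G)\<^sup>2 / (5/2) ^ 3) / 2 \<le> min 3 (euclid_dist t (JL_col t G a) (JL_col t G b))" for G
  proof -
    \<comment> \<open>The parabola peaks at 75/8 with the value 45/16, so the truncation does not
      cut into the minorant.\<close>
    have "(3 * ?U G / (5/2) - (?U G)\<^sup>2 / (5/2) ^ 3) / 2 \<le> 3"
      using zero_le_power2[of "?U G - 9"] sum_power2_ge_zero[of "?U G - 9" 0]
        zero_le_power2[of "?U G - 75/8"] by (simp add: power2_eq_square field_simps)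
    then show ?thesis
      using sqrt_ge_quadratic[of "?U G" "5/2"] by (simp add: euclid_dist_JL_col sum_nonneg)
  qed
  ultimately have "(3 * expectation ?U / (5/2) - expectation (\<lambda>G. (?U G)\<^sup>2) / (5/2) ^ 3) / 2
    \<le> expectation (\<lambda>G. min 3 (euclid_dist t (JL_col t G a) (JL_col t G b)))"
    by (rule expectation_ge_quadratic)
  moreover have "expectation ?U = 2" using U t by simp
  moreover have "expectation (\<lambda>G. (?U G)\<^sup>2) \<le> 12"
  proof -
    have "expectation (\<lambda>G. (?U G)\<^sup>2) = ((real t)\<^sup>2 + 2 * real t) * (4 / (real t)\<^sup>2)" using U by (simp add: s4)
    also have "\<dots> = 4 + 8 / t" using t by (simp add: field_simps power2_eq_square)
    also have "\<dots> \<le> 12" using t by (simp add: field_simps)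
    finally show ?thesis .
  qed
  ultimately show ?thesis by (simp add: field_simps)
qed

end

section \<open>Truncated norms of columns\<close>

text \<open>Points of norm above 2 count 0 rather than 2: they then cause no loss in whatever cell
  they are put, and the values stay bounded.\<close>

definition cut_norm :: "nat \<Rightarrow> (nat \<Rightarrow> real) \<Rightarrow> real" where
  "cut_norm t y = (if (\<Sum>i<t. (y i)\<^sup>2) \<le> 4 then sqrt (\<Sum>i<t. (y i)\<^sup>2) else 0)"

lemma cut_norm_nonneg: "cut_norm t y \<ge> 0"
  by (auto simp: cut_norm_def sum_nonneg)

lemma cut_norm_le_2: "cut_norm t y \<le> 2"
  by (auto simp: cut_norm_def intro!: real_le_lsqrt)

lemma measurable_sum_squares: "(\<lambda>y. \<Sum>i<t. (y i)\<^sup>2) \<in> borel_measurable (vecM t)"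
  by (intro borel_measurable_sum borel_measurable_power measurable_component_singleton) auto

lemma measurable_cut_norm: "cut_norm t \<in> borel_measurable (vecM t)"
  unfolding cut_norm_def
  by (intro measurable_If measurable_compose[OF _ borel_measurable_sqrt] measurable_sum_squares borel_measurable_le
      borel_measurable_const)

text \<open>The squared norm has mean 1 and second moment 1 + 2/t, so the quadratic that touches the
  root at 1 yields (3 - 1 - 2/t) / 2.\<close>

lemma expectation_cut_norm_ge:
  assumes t: "t > 0" and j: "j < n" and s: "\<bar>s\<bar> = 1"
  shows "(\<integral>G. cut_norm t (column t s j G) \<partial>gauss_JL t n) \<ge> 1 - 1 / t"
proof -
  interpret prob_space "gauss_JL t n" by (rule prob_space_gauss_JL[OF t])
  let ?U = "\<lambda>G. \<Sum>i<t. (G (i, j))\<^sup>2"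
  have "s\<^sup>2 = 1" using s by (metis one_power2 power2_abs)
  then have UU: "(\<Sum>i<t. (column t s j G i)\<^sup>2) = ?U G" for G
    by (intro sum.cong) (auto simp: column_def power_mult_distrib)
  have "indep_vars (\<lambda>i. PiM {(i, j)} (\<lambda>_. borel)) (\<lambda>i G. restrict (\<lambda>p. G p) {(i, j)}) {..<t}"
    by (rule indep_vars_restrict[OF indep_gauss_JL_components[OF t]]) (use j in \<open>auto simp: disjoint_family_on_def\<close>)
  then have "indep_vars (\<lambda>_. borel) (\<lambda>i G. restrict (\<lambda>p. G p) {(i, j)} (i, j)) {..<t}"
    by (rule indep_vars_compose2) auto
  then have ind: "indep_vars (\<lambda>_. borel) (\<lambda>i G. G (i, j)) {..<t}" by simp
  have "distributed (gauss_JL t n) lborel (\<lambda>G. G (i, j)) (normal_density 0 (1 / sqrt t))" if "i \<in> {..<t}" for i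
    using distributed_gauss_JL_component[OF t, of "(i, j)" n] that j by auto
  note U = sum_squares_normal[OF finite_lessThan ind _ this, simplified, OF t]
  have "integrable (gauss_JL t n) ?U" "integrable (gauss_JL t n) (\<lambda>G. (?U G)\<^sup>2)" using U by auto
  moreover have "integrable (gauss_JL t n) (\<lambda>G. cut_norm t (column t s j G))"
    using measurable_compose[OF measurable_column[OF j] measurable_cut_norm]
    by (intro integrable_const_bound[where B=2]) (auto simp: cut_norm_nonneg cut_norm_le_2)
  moreover have "(3 * ?U G / 1 - (?U G)\<^sup>2 / 1 ^ 3) / 2 \<le> cut_norm t (column t s j G)" for G
  proof (cases "?U G \<le> 4")
    case True
    then show ?thesis using sqrt_ge_quadratic[of "?U G" 1] by (simp add: cut_norm_def UU sum_nonneg)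
  next
    case False
    \<comment> \<open>Beyond 4 the quadratic is at most 0, so cutting the norm down to 0 costs
      nothing.\<close>
    then have "?U G * (3 - ?U G) \<le> 0" by (intro mult_nonneg_nonpos) auto
    moreover have "3 * ?U G - (?U G)\<^sup>2 = ?U G * (3 - ?U G)" by (simp add: power2_eq_square algebra_simps)
    ultimately show ?thesis using False by (simp add: cut_norm_def UU)
  qed
  ultimately have "(3 * expectation ?U / 1 - expectation (\<lambda>G. (?U G)\<^sup>2) / 1 ^ 3) / 2
    \<le> expectation (\<lambda>G. cut_norm t (column t s j G))"
    by (rule expectation_ge_quadratic)
  moreover have "expectation ?U = 1" using U t by (simp add: power_divide)
  moreover have "expectation (\<lambda>G. (?U G)\<^sup>2) = 1 + 2 / t"
  proof -
    have "(1 / sqrt (real t)) ^ 4 = 1 / (real t)\<^sup>2"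
      by (simp add: power_divide sqrt_power4)
    then have "expectation (\<lambda>G. (?U G)\<^sup>2) = ((real t)\<^sup>2 + 2 * real t) * (1 / (real t)\<^sup>2)" using U by simp
    also have "\<dots> = 1 + 2 / t" using t by (simp add: field_simps power2_eq_square)
    finally show ?thesis .
  qed
  ultimately show ?thesis by (simp add: field_simps)
qed

subsection \<open>Lattice cells\<close>

text \<open>Rounding to a lattice of mesh \<open>\<eta>\<close>. Everything outside the ball of
  radius 2 goes to the cell of the origin, so finitely many cells suffice.\<close>

definition cell :: "nat \<Rightarrow> real \<Rightarrow> (nat \<Rightarrow> real) \<Rightarrow> nat \<Rightarrow> int" where
  "cell t \<eta> y = (\<lambda>i\<in>{..<t}. if (\<Sum>i<t. (y i)\<^sup>2) \<le> 4 then \<lfloor>y i / \<eta>\<rfloor> else 0)"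

text \<open>Lattice points of l1 norm at most \<open>m\<close>. The box supplies finiteness and a
  product structure, but alone it would bring in a factor of order t^t, since \<open>m\<close> grows
  in proportion to \<open>t\<close>.\<close>

definition cells :: "nat \<Rightarrow> nat \<Rightarrow> (nat \<Rightarrow> int) set" where
  "cells t m = {z \<in> {..<t} \<rightarrow>\<^sub>E {- int m..int m}. (\<Sum>i<t. nat \<bar>z i\<bar>) \<le> m}"

lemma finite_cells: "finite (cells t m)"
  unfolding cells_def by (rule finite_subset[OF _ finite_PiE[of "{..<t}" "\<lambda>_. {- int m..int m}"]]) auto

lemma sum_power_abs_le:
  fixes q :: real
  assumes "0 < q" "q < 1"
  shows "(\<Sum>k\<in>{- int m..int m}. q ^ nat \<bar>k\<bar>) \<le> 2 / (1 - q)"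
proof -
  have geo: "(\<Sum>k\<le>m. q ^ k) \<le> 1 / (1 - q)"
    using sum_le_suminf[of "\<lambda>k. q ^ k" "{..m}"] assms suminf_geometric[of q] by (simp add: summable_geometric)
  have "{- int m..int m} \<subseteq> int ` {..m} \<union> (\<lambda>k. - int k) ` {..m}"
  proof
    fix k assume "k \<in> {- int m..int m}"
    then show "k \<in> int ` {..m} \<union> (\<lambda>k. - int k) ` {..m}"
      by (cases "k \<ge> 0") (auto intro!: image_eqI[of _ _ "nat \<bar>k\<bar>"])
  qed
  then have "(\<Sum>k\<in>{- int m..int m}. q ^ nat \<bar>k\<bar>) \<le> (\<Sum>k\<in>int ` {..m} \<union> (\<lambda>k. - int k) ` {..m}. q ^ nat \<bar>k\<bar>)"
    using assms by (intro sum_mono2) auto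
  also have "\<dots> \<le> (\<Sum>k\<in>int ` {..m}. q ^ nat \<bar>k\<bar>) + (\<Sum>k\<in>(\<lambda>k. - int k) ` {..m}. q ^ nat \<bar>k\<bar>)"
    by (subst sum.union_inter[symmetric]) (use assms in \<open>auto intro: sum_nonneg\<close>)
  also have "\<dots> = 2 * (\<Sum>k\<le>m. q ^ k)"
    by (subst (1 2) sum.reindex) (auto simp: inj_on_def)
  finally show ?thesis using geo by simp
qed

text \<open>Rankin's trick: each point of \<open>cells t m\<close> has weight at least \<open>q ^ m\<close> under the product of
  geometric weights \<open>q ^ \<bar>k\<bar>\<close>.\<close>
lemma card_cells_le:
  fixes q :: real
  assumes "0 < q" "q < 1"
  shows "real (card (cells t m)) \<le> (1 / q) ^ m * (2 / (1 - q)) ^ t"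
proof -
  have "real (card (cells t m)) * q ^ m = (\<Sum>z\<in>cells t m. q ^ m)" by simp
  also have "\<dots> \<le> (\<Sum>z\<in>cells t m. q ^ (\<Sum>i<t. nat \<bar>z i\<bar>))"
    using assms by (intro sum_mono power_decreasing) (auto simp: cells_def)
  also have "\<dots> \<le> (\<Sum>z\<in>{..<t} \<rightarrow>\<^sub>E {- int m..int m}. q ^ (\<Sum>i<t. nat \<bar>z i\<bar>))"
    using assms by (intro sum_mono2 finite_PiE) (auto simp: cells_def)
  also have "\<dots> = (\<Sum>z\<in>{..<t} \<rightarrow>\<^sub>E {- int m..int m}. \<Prod>i<t. q ^ nat \<bar>z i\<bar>)"
    by (simp add: power_sum)
  also have "\<dots> = (\<Prod>i<t. \<Sum>k\<in>{- int m..int m}. q ^ nat \<bar>k\<bar>)"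
    by (rule prod_sum_PiE[symmetric]) auto
  also have "\<dots> = (\<Sum>k\<in>{- int m..int m}. q ^ nat \<bar>k\<bar>) ^ t" by simp
  also have "\<dots> \<le> (2 / (1 - q)) ^ t"
    using sum_power_abs_le[OF assms] assms by (intro power_mono sum_nonneg) auto
  finally show ?thesis using assms by (simp add: field_simps)
qed

text \<open>Cauchy-Schwarz against the all-ones vector.\<close>

lemma sum_abs_le_sqrt_card:
  fixes y :: "nat \<Rightarrow> real" and t :: nat
  shows "(\<Sum>i<t. \<bar>y i\<bar>) \<le> sqrt t * sqrt (\<Sum>i<t. (y i)\<^sup>2)"
  using L2_set_mult_ineq[of "\<lambda>_. 1" y "{..<t}"] by (simp add: L2_set_def)

lemma cell_in_cells:
  assumes t: "t > 0" and \<delta>: "\<delta> > 0" and m: "real t * (2 / \<delta> + 1) \<le> real m + 1"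
  shows "cell t (\<delta> / sqrt t) y \<in> cells t m"
proof -
  define z where "z = cell t (\<delta> / sqrt t) y"
  \<comment> \<open>Rounding changes each coordinate by less than 1, and the l1 norm is at most
    \<open>sqrt t\<close> times the Euclidean norm. The sum is an integer, so being below
    \<open>m + 1\<close> puts it at most at \<open>m\<close>.\<close>
  have "(\<Sum>i<t. real_of_int \<bar>z i\<bar>) < real m + 1"
  proof (cases "(\<Sum>i<t. (y i)\<^sup>2) \<le> 4")
    case True
    let ?\<eta> = "\<delta> / sqrt t"
    have "real_of_int \<bar>z i\<bar> < \<bar>y i\<bar> / ?\<eta> + 1" if "i < t" for i
    proof -
      have "z i = \<lfloor>y i / ?\<eta>\<rfloor>" using True that by (simp add: z_def cell_def)
      moreover have "\<bar>y i\<bar> / ?\<eta> = \<bar>y i / ?\<eta>\<bar>" using \<delta> by (simp add: abs_mult)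
      ultimately show ?thesis by linarith
    qed
    then have "(\<Sum>i<t. real_of_int \<bar>z i\<bar>) < (\<Sum>i<t. \<bar>y i\<bar> / ?\<eta> + 1)"
      using t by (intro sum_strict_mono) auto
    also have "\<dots> = (\<Sum>i<t. \<bar>y i\<bar>) * sqrt t / \<delta> + t"
      by (simp add: sum.distrib sum_distrib_right sum_divide_distrib)
    also have "\<dots> \<le> (sqrt t * 2) * sqrt t / \<delta> + t"
    proof -
      have "sqrt (\<Sum>i<t. (y i)\<^sup>2) \<le> 2" using True by (intro real_le_lsqrt) (auto simp: sum_nonneg)
      then have "(\<Sum>i<t. \<bar>y i\<bar>) \<le> sqrt t * 2"
        using sum_abs_le_sqrt_card[of y t] by (meson mult_left_mono order_trans real_sqrt_ge_zero of_nat_0_le_iff)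
      then show ?thesis using \<delta> by (intro add_right_mono divide_right_mono mult_right_mono) auto
    qed
    also have "\<dots> = real t * (2 / \<delta> + 1)" by (simp add: field_simps)
    finally show ?thesis using m by simp
  next
    case False
    then have "(\<Sum>i<t. real_of_int \<bar>z i\<bar>) = 0" by (auto simp: z_def cell_def)
    then show ?thesis by simp
  qed
  then have "real_of_int (\<Sum>i<t. \<bar>z i\<bar>) < real_of_int (int m + 1)" by simp
  then have sum: "(\<Sum>i<t. \<bar>z i\<bar>) \<le> int m" by linarith
  have "\<bar>z i\<bar> \<le> int m" if "i < t" for i
    using member_le_sum[of i "{..<t}" "\<lambda>i. \<bar>z i\<bar>"] sum that by simp
  then have "z i \<in> {- int m..int m}" if "i < t" for i
    using that unfolding atLeastAtMost_iff by (smt (verit))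
  then have "z \<in> {..<t} \<rightarrow>\<^sub>E {- int m..int m}"
    by (intro PiE_I) (simp_all add: z_def cell_def)
  moreover have "int (\<Sum>i<t. nat \<bar>z i\<bar>) = (\<Sum>i<t. \<bar>z i\<bar>)" by simp
  ultimately show ?thesis using sum unfolding cells_def z_def by (auto simp del: of_nat_sum)
qed

lemma sets_cell_eq: "{y \<in> space (vecM t). cell t \<eta> y = z} \<in> sets (vecM t)"
proof (cases "z \<in> extensional {..<t}")
  case True
  let ?f = "\<lambda>y i. if (\<Sum>i<t. (y i)\<^sup>2) \<le> 4 then \<lfloor>y i / \<eta>\<rfloor> else 0"
  have "cell t \<eta> y = z \<longleftrightarrow> (\<forall>i\<in>{..<t}. real_of_int (?f y i) = real_of_int (z i))" for y
    using True by (auto simp: cell_def fun_eq_iff extensional_def restrict_def)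
  moreover have "{y \<in> space (vecM t). \<forall>i\<in>{..<t}. real_of_int (?f y i) = real_of_int (z i)} \<in> sets (vecM t)"
  proof (intro sets.sets_Collect_finite_All)
    fix i assume i: "i \<in> {..<t}"
    note [measurable] = measurable_sum_squares[of t] measurable_component_singleton[OF i, of "\<lambda>_. borel :: real measure"]
    show "{y \<in> space (vecM t). real_of_int (?f y i) = real_of_int (z i)} \<in> sets (vecM t)" by measurable
  qed simp
  ultimately show ?thesis by simp
next
  case False
  then have "{y \<in> space (vecM t). cell t \<eta> y = z} = {}" by (auto simp: cell_def)
  then show ?thesis by (simp only: sets.empty_sets)
qed

text \<open>The mesh \<open>\<delta> / sqrt t\<close> gives cells of diameter at most \<delta>. Then
  2 |u| <= |u + w| + |u - w| <= |u + w| + \<delta>, likewise for w, and the two bounds are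
  averaged.\<close>

lemma norm_sum_ge_of_cell_eq:
  assumes t: "t > 0" and \<delta>: "\<delta> > 0"
    and eq: "cell t (\<delta> / sqrt t) y = cell t (\<delta> / sqrt t) y'"
  shows "sqrt (\<Sum>i<t. (y i + y' i)\<^sup>2) \<ge> cut_norm t y + cut_norm t y' - \<delta>"
proof -
  define \<eta> where "\<eta> = \<delta> / sqrt t"
  have \<eta>: "\<eta> > 0" "t * \<eta>\<^sup>2 = \<delta>\<^sup>2" using t \<delta> by (auto simp: \<eta>_def power_divide)
  note eq = eq[folded \<eta>_def]
  have small: "sqrt (\<Sum>i<t. (w i)\<^sup>2) \<le> \<delta>" if w: "\<And>i. i < t \<Longrightarrow> \<bar>w i\<bar> \<le> \<eta>" for w :: "nat \<Rightarrow> real"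
  proof -
    have "(\<Sum>i<t. (w i)\<^sup>2) \<le> (\<Sum>i<t. \<eta>\<^sup>2)"
      using w \<eta> by (intro sum_mono) (simp add: abs_le_square_iff[symmetric])
    also have "\<dots> = \<delta>\<^sup>2" using \<eta>(2) by simp
    finally show ?thesis using \<delta> by (intro real_le_lsqrt) (auto simp: sum_nonneg)
  qed
  \<comment> \<open>Only one of the two points is assumed to lie in the ball; the other case follows
    by symmetry.\<close>
  have half: "sqrt (\<Sum>i<t. (u i + w i)\<^sup>2) \<ge> cut_norm t u + cut_norm t w - \<delta>"
    if eq: "cell t \<eta> u = cell t \<eta> w" and u: "(\<Sum>i<t. (u i)\<^sup>2) \<le> 4" for u w
  proof (cases "(\<Sum>i<t. (w i)\<^sup>2) \<le> 4")
    case True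
    have "\<bar>u i - w i\<bar> \<le> \<eta>" if "i < t" for i
    proof -
      have "\<lfloor>u i / \<eta>\<rfloor> = \<lfloor>w i / \<eta>\<rfloor>" using fun_cong[OF eq, of i] True u that by (simp add: cell_def)
      then have "\<bar>u i / \<eta> - w i / \<eta>\<bar> \<le> 1" by linarith
      moreover have "\<bar>u i / \<eta> - w i / \<eta>\<bar> = \<bar>u i - w i\<bar> / \<eta>"
        using \<eta>(1) by (metis abs_divide abs_of_pos diff_divide_distrib)
      ultimately have "\<bar>u i - w i\<bar> / \<eta> \<le> 1" by simp
      then show ?thesis using \<eta> by (simp add: divide_le_eq)
    qed
    then have d: "L2_set (\<lambda>i. u i - w i) {..<t} \<le> \<delta>" using small[of "\<lambda>i. u i - w i"] by (simp add: L2_set_def)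
    then have d': "L2_set (\<lambda>i. w i - u i) {..<t} \<le> \<delta>" by (simp add: L2_set_def power2_commute)
    have "2 * L2_set u {..<t} = L2_set (\<lambda>i. (u i + w i) + (u i - w i)) {..<t}"
      by (simp add: L2_set_right_distrib)
    also have "\<dots> \<le> L2_set (\<lambda>i. u i + w i) {..<t} + L2_set (\<lambda>i. u i - w i) {..<t}" by (rule L2_set_triangle_ineq)
    finally have 1: "2 * L2_set u {..<t} \<le> L2_set (\<lambda>i. u i + w i) {..<t} + \<delta>" using d by simp
    have "2 * L2_set w {..<t} = L2_set (\<lambda>i. (u i + w i) + (w i - u i)) {..<t}"
      by (simp add: L2_set_right_distrib)
    also have "\<dots> \<le> L2_set (\<lambda>i. u i + w i) {..<t} + L2_set (\<lambda>i. w i - u i) {..<t}" by (rule L2_set_triangle_ineq)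
    finally have 2: "2 * L2_set w {..<t} \<le> L2_set (\<lambda>i. u i + w i) {..<t} + \<delta>" using d' by simp
    show ?thesis using 1 2 True u by (simp add: cut_norm_def L2_set_def)
  next
    \<comment> \<open>Here \<open>w\<close> was sent to the cell of the origin, so \<open>u\<close>
      lies there too and has norm at most \<delta>.\<close>
    case False
    have "\<bar>u i\<bar> \<le> \<eta>" if "i < t" for i
    proof -
      have "\<lfloor>u i / \<eta>\<rfloor> = 0" using fun_cong[OF eq, of i] False u that by (simp add: cell_def)
      then have "\<bar>u i / \<eta>\<bar> \<le> 1" by linarith
      then show ?thesis using \<eta> by (simp add: divide_le_eq)
    qed
    then have "cut_norm t u \<le> \<delta>" using small[of u] \<delta> by (simp add: cut_norm_def)
    moreover have "sqrt (\<Sum>i<t. (u i + w i)\<^sup>2) \<ge> 0" by (simp add: sum_nonneg)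
    moreover have "cut_norm t w = 0" using False by (simp add: cut_norm_def)
    ultimately show ?thesis by linarith
  qed
  consider "(\<Sum>i<t. (y i)\<^sup>2) \<le> 4" | "(\<Sum>i<t. (y' i)\<^sup>2) \<le> 4" | "\<not> (\<Sum>i<t. (y i)\<^sup>2) \<le> 4" "\<not> (\<Sum>i<t. (y' i)\<^sup>2) \<le> 4"
    by blast
  then show ?thesis
  proof cases
    case 1
    then show ?thesis using half[OF eq] by simp
  next
    case 2
    then show ?thesis using half[OF eq[symmetric]] by (simp add: add.commute)
  next
    case 3
    then have "cut_norm t y = 0" "cut_norm t y' = 0" by (simp_all add: cut_norm_def)
    moreover have "sqrt (\<Sum>i<t. (y i + y' i)\<^sup>2) \<ge> 0" by (simp add: sum_nonneg)
    ultimately show ?thesis using \<delta> by linarith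
  qed
qed

subsection \<open>Concentration\<close>

context prob_space
begin

lemma prob_ge_of_AE_cover:
  assumes "A \<in> events" "B \<in> events" "AE x in M. x \<in> A \<or> x \<in> B"
  shows "prob A \<ge> 1 - prob B"
proof -
  have "AE x in M. x \<in> A \<union> B" using assms(3) by simp
  then have "prob (A \<union> B) = 1" using assms by (intro prob_eq_1[THEN iffD2]) auto
  then show ?thesis using measure_Un_le[OF assms(1,2)] by simp
qed

text \<open>The lower tail admits any lower bound \<open>\<mu>\<close> of the mean, as mean norms
  and mean distances are known only from below.\<close>

lemma Hoeffding_bounded:
  fixes X :: "'i \<Rightarrow> 'a \<Rightarrow> real" and a b D \<mu> :: real
  assumes I: "finite I" "I \<noteq> {}" and ind: "indep_vars (\<lambda>_. borel) X I"
    and X: "\<And>i x. i \<in> I \<Longrightarrow> x \<in> space M \<Longrightarrow> a \<le> X i x \<and> X i x \<le> b" and "a < b" and D: "D \<ge> 0"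
  shows "(\<Sum>i\<in>I. expectation (X i)) \<ge> \<mu> \<Longrightarrow>
      prob {x \<in> space M. (\<Sum>i\<in>I. X i x) \<le> \<mu> - D} \<le> exp (- 2 * D\<^sup>2 / (card I * (b - a)\<^sup>2))"
    and "prob {x \<in> space M. \<bar>(\<Sum>i\<in>I. X i x) - (\<Sum>i\<in>I. expectation (X i))\<bar> \<ge> D}
      \<le> 2 * exp (- 2 * D\<^sup>2 / (card I * (b - a)\<^sup>2))"
proof -
  interpret Hoeffding_ineq M I X "\<lambda>_. a" "\<lambda>_. b" "\<Sum>i\<in>I. expectation (X i)"
    by unfold_locales (use I ind X in auto)
  have pos: "(\<Sum>i\<in>I. (b - a)\<^sup>2) > 0" using I \<open>a < b\<close> by (intro sum_pos) auto
  show "prob {x \<in> space M. \<bar>(\<Sum>i\<in>I. X i x) - (\<Sum>i\<in>I. expectation (X i))\<bar> \<ge> D}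
      \<le> 2 * exp (- 2 * D\<^sup>2 / (card I * (b - a)\<^sup>2))"
    using Hoeffding_ineq_abs_ge[OF D pos] by simp
  assume \<mu>: "(\<Sum>i\<in>I. expectation (X i)) \<ge> \<mu>"
  have [measurable]: "X i \<in> borel_measurable M" if "i \<in> I" for i using that by (rule random_variable)
  have "prob {x \<in> space M. (\<Sum>i\<in>I. X i x) \<le> \<mu> - D}
      \<le> prob {x \<in> space M. (\<Sum>i\<in>I. X i x) \<le> (\<Sum>i\<in>I. expectation (X i)) - D}"
    using \<mu> by (intro finite_measure_mono) auto
  also have "\<dots> \<le> exp (- 2 * D\<^sup>2 / (card I * (b - a)\<^sup>2))"
    using Hoeffding_ineq_le[OF D pos] by simp
  finally show "prob {x \<in> space M. (\<Sum>i\<in>I. X i x) \<le> \<mu> - D} \<le> exp (- 2 * D\<^sup>2 / (card I * (b - a)\<^sup>2))" .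
qed

end

section \<open>The alternating tour on the random image\<close>

lemma opt_max_tsp_JL_ge_path_cost:
  assumes inj: "inj_on (JL_col t G) {..<n}" and xs: "distinct xs" "set xs = {..<n}"
  shows "path_cost (\<lambda>a b. euclid_dist t (JL_col t G a) (JL_col t G b)) xs
    \<le> opt_max_tsp (euclid_dist t) (JL_image t n G)"
proof -
  have "path_cost (\<lambda>a b. euclid_dist t (JL_col t G a) (JL_col t G b)) xs
      \<le> cycle_cost (euclid_dist t) (map (JL_col t G) xs)"
    unfolding cycle_cost_map by (rule path_cost_le_cycle_cost) (rule euclid_dist_nonneg)
  moreover have "distinct (map (JL_col t G) xs)" "set (map (JL_col t G) xs) = JL_image t n G"
    using xs inj by (auto simp: distinct_map JL_image_eq)
  moreover have "finite (JL_image t n G)" by (simp add: JL_image_eq)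
  ultimately show ?thesis by (subst le_opt_max_tsp_iff) blast+
qed

definition flip :: "nat \<Rightarrow> nat \<Rightarrow> real" where
  "flip h j = (if j < h then 1 else - 1)"

lemma abs_flip: "\<bar>flip h j\<bar> = 1"
  by (simp add: flip_def)

text \<open>The deterministic core: for a fixed matrix, the loss is governed by the cell diameter,
  the number of cells and their imbalances.\<close>

lemma opt_max_tsp_JL_ge:
  fixes t n h m :: nat and G \<delta>
  defines "Y \<equiv> \<lambda>j. column t (flip h j) j G"
  defines "key \<equiv> \<lambda>j. cell t (\<delta> / sqrt t) (Y j)"
  assumes t: "t > 0" and \<delta>: "\<delta> > 0" and m: "real t * (2 / \<delta> + 1) \<le> real m + 1" and h: "h \<le> n"
    and inj: "inj_on (JL_col t G) {..<n}"
  shows "opt_max_tsp (euclid_dist t) (JL_image t n G)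
    \<ge> 2 * (\<Sum>j<n. cut_norm t (Y j)) - \<delta> * n - 4 *
      (\<Sum>z\<in>cells t m. \<bar>real (card {x. x < h \<and> key x = z}) - real (card {y. h \<le> y \<and> y < n \<and> key y = z})\<bar> + 1) - 4"
proof -
  define d where "d a b = euclid_dist t (JL_col t G a) (JL_col t G b)" for a b
  define R where "R a b \<longleftrightarrow> d a b \<ge> cut_norm t (Y a) + cut_norm t (Y b) - \<delta>" for a b
  have sym: "d a b = d b a" for a b by (simp add: d_def euclid_dist_def power2_commute)
  have key: "R a b \<and> R b a" if "a < h" "h \<le> b" "b < n" "key a = key b" for a b
  proof -
    \<comment> \<open>The two signs are opposite, so the difference of the columns is the sum of the
      flipped ones.\<close>
    have "d a b = sqrt (\<Sum>i<t. (Y a i + Y b i)\<^sup>2)"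
      using that unfolding d_def euclid_dist_JL_col
      by (intro arg_cong[of _ _ sqrt] sum.cong) (auto simp: Y_def column_def flip_def)
    then have "R a b"
      using norm_sum_ge_of_cell_eq[OF t \<delta>] that unfolding R_def key_def by simp
    then show ?thesis using sym[of a b] by (simp add: R_def add.commute)
  qed
  have keyK: "key ` {..<n} \<subseteq> cells t m"
    unfolding key_def using cell_in_cells[OF t \<delta> m] by blast
  obtain xs where xs: "distinct xs" "set xs = {..<n}"
    and jumps: "real (jumps R xs) \<le> (\<Sum>z\<in>cells t m. \<bar>real (card {x. x < h \<and> key x = z})
      - real (card {y. h \<le> y \<and> y < n \<and> key y = z})\<bar> + 1)"
    by (rule ex_list_few_jumps[OF finite_cells keyK h key]) blast+
  have len: "length xs = n" using xs distinct_card[of xs] by simp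
  have sum: "sum_list (map (\<lambda>j. cut_norm t (Y j)) xs) = (\<Sum>j<n. cut_norm t (Y j))"
    using xs by (simp add: sum_list_distinct_conv_sum_set)
  have "2 * sum_list (map (\<lambda>j. cut_norm t (Y j)) xs) - \<delta> * length xs - 4 * jumps R xs - 4 \<le> path_cost d xs"
    by (rule path_cost_lower_bound) (use \<delta> in \<open>auto simp: d_def R_def euclid_dist_nonneg cut_norm_nonneg cut_norm_le_2\<close>)
  also have "\<dots> \<le> opt_max_tsp (euclid_dist t) (JL_image t n G)"
    unfolding d_def by (rule opt_max_tsp_JL_ge_path_cost[OF inj xs])
  finally show ?thesis using jumps by (simp add: len sum)
qed

text \<open>On the good event the truncated norms sum to more than n (1 - 1/t) - D and every cell
  has imbalance at most D + 1; together with 1 for the seam this is \<open>D + 2\<close> per cell.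
  The failure probability is a union bound over one tail for the norms and two for each
  cell.\<close>

lemma prob_opt_max_tsp_JL_ge:
  fixes t n m :: nat and \<delta> D r :: real
  assumes t: "t > 0" and n: "n > 0" and \<delta>: "\<delta> > 0" and m: "real t * (2 / \<delta> + 1) \<le> real m + 1"
    and D: "D \<ge> 0"
    and r: "r \<le> 2 * (n * (1 - 1 / t) - D) - \<delta> * n - 4 * (card (cells t m) * (D + 2)) - 4"
  shows "measure (gauss_JL t n) {G \<in> space (gauss_JL t n). r \<le> opt_max_tsp (euclid_dist t) (JL_image t n G)}
    \<ge> 1 - (2 * card (cells t m) + 1) * exp (- D\<^sup>2 / (2 * n))"
proof -
  interpret prob_space "gauss_JL t n" by (rule prob_space_gauss_JL[OF t])
  let ?M = "gauss_JL t n"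
  define h where "h = n div 2"
  define s where "s = flip h"
  have s: "\<bar>s j\<bar> = 1" for j by (simp add: s_def abs_flip)
  define Y where "Y j = column t (s j) j" for j
  define \<eta> where "\<eta> = \<delta> / sqrt t"
  \<comment> \<open>Summed over \<open>j\<close>, these signed indicators give the first-half count
    of cell \<open>z\<close> minus its second-half count.\<close>
  define X where "X z j G = s j * (if cell t \<eta> (Y j G) = z then 1 else 0)" for z j G
  define B0 where "B0 = {G \<in> space ?M. (\<Sum>j<n. cut_norm t (Y j G)) \<le> n * (1 - 1 / t) - D}"
  define B where "B z = {G \<in> space ?M. \<bar>(\<Sum>j<n. X z j G) - (\<Sum>j<n. expectation (X z j))\<bar> \<ge> D}" for z
  define E where "E = {G \<in> space ?M. r \<le> opt_max_tsp (euclid_dist t) (JL_image t n G)}"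
  have indY: "indep_vars (\<lambda>_. vecM t) Y {..<n}"
    using indep_columns[OF t] unfolding Y_def[abs_def] .
  have ind0: "indep_vars (\<lambda>_. borel) (\<lambda>j G. cut_norm t (Y j G)) {..<n}"
    by (rule indep_vars_compose2[OF indY]) (rule measurable_cut_norm)
  have meas_cell: "(\<lambda>y. if cell t \<eta> y = z then 1 else 0 :: real) \<in> borel_measurable (vecM t)" for z
    by (rule measurable_If) (auto intro: sets_cell_eq)
  have indX: "indep_vars (\<lambda>_. borel) (X z) {..<n}" for z
    unfolding X_def[abs_def]
    by (rule indep_vars_compose2[OF indY]) (intro borel_measurable_times borel_measurable_const meas_cell)
  have B0: "prob B0 \<le> exp (- D\<^sup>2 / (2 * n))"
  proof -
    have "(\<Sum>j<n. expectation (\<lambda>G. cut_norm t (Y j G))) \<ge> (\<Sum>j<n. 1 - 1 / t)"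
      unfolding Y_def by (intro sum_mono expectation_cut_norm_ge t s) auto
    then have "(\<Sum>j<n. expectation (\<lambda>G. cut_norm t (Y j G))) \<ge> n * (1 - 1 / t)" by simp
    \<comment> \<open>The values span an interval of length 2, as they do for the signed indicators;
      hence the common exponent D^2 / (2n).\<close>
    from Hoeffding_bounded(1)[OF _ _ ind0 _ _ D this, of 0 2] n
    show ?thesis by (simp add: B0_def cut_norm_nonneg cut_norm_le_2 lessThan_empty_iff)
  qed
  have B: "prob (B z) \<le> 2 * exp (- D\<^sup>2 / (2 * n))" for z
  proof -
    have "- 1 \<le> X z j G \<and> X z j G \<le> 1" for j G by (auto simp: X_def s_def flip_def)
    from Hoeffding_bounded(2)[OF _ _ indX this _ D] n
    show ?thesis by (simp add: B_def lessThan_empty_iff)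
  qed
  \<comment> \<open>By symmetry every column hits the cell with the same probability
    \<open>p\<close>. The signs cancel, up to one left over when \<open>n\<close> is odd.\<close>
  have EX: "\<bar>\<Sum>j<n. expectation (X z j)\<bar> \<le> 1" for z
  proof -
    define p where "p = expectation (\<lambda>G. if cell t \<eta> (Y 0 G) = z then 1 else 0 :: real)"
    have "expectation (X z j) = s j * p" if "j < n" for j
    proof -
      have "expectation (X z j) = s j * expectation (\<lambda>G. if cell t \<eta> (Y j G) = z then 1 else 0 :: real)"
        unfolding X_def by simp
      also have "expectation (\<lambda>G. if cell t \<eta> (Y j G) = z then 1 else 0 :: real) = p"
        unfolding p_def Y_def by (rule expectation_column_eq[OF t meas_cell s s that n])
      finally show ?thesis .
    qed
    then have "(\<Sum>j<n. expectation (X z j)) = (\<Sum>j<n. s j) * p" by (simp add: sum_distrib_right)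
    moreover have "\<bar>\<Sum>j<n. s j\<bar> \<le> 1"
    proof -
      have "(\<Sum>j<n. s j) = (\<Sum>j\<in>{..<h} \<union> {h..<n}. s j)"
        by (intro sum.cong) (auto simp: h_def)
      also have "\<dots> = (\<Sum>j<h. 1) + (\<Sum>j\<in>{h..<n}. - 1)"
        by (subst sum.union_disjoint) (auto simp: s_def flip_def)
      also have "\<dots> = real h - real (n - h)" by simp
      finally show ?thesis unfolding h_def by linarith
    qed
    moreover have "\<bar>p\<bar> \<le> 1"
    proof -
      have "0 \<le> p" unfolding p_def by (intro Bochner_Integration.integral_nonneg) auto
      moreover have "p \<le> expectation (\<lambda>G. 1)" unfolding p_def
        using measurable_compose[OF measurable_column[OF n] meas_cell]
        by (intro integral_mono integrable_const_bound[where B=1]) (auto simp: Y_def)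
      ultimately show ?thesis by (simp add: prob_space)
    qed
    ultimately show ?thesis using mult_mono[of "\<bar>\<Sum>j<n. s j\<bar>" 1 "\<bar>p\<bar>" 1] by (simp add: abs_mult)
  qed
  have events: "B0 \<in> events" "B z \<in> events" for z
  proof -
    have "(\<lambda>G. cut_norm t (Y j G)) \<in> borel_measurable ?M" "X z j \<in> borel_measurable ?M" if "j < n" for j z
      using ind0 indX[of z] that by (auto simp: indep_vars_def)
    then show "B0 \<in> events" "B z \<in> events" unfolding B0_def B_def by measurable
  qed
  have cover: "G \<in> E \<or> G \<in> B0 \<union> (\<Union>z\<in>cells t m. B z)"
    if G: "G \<in> space ?M" and inj: "inj_on (JL_col t G) {..<n}" for G
  proof (rule disjCI)
    assume nB: "G \<notin> B0 \<union> (\<Union>z\<in>cells t m. B z)"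
    define W where "W z = \<bar>real (card {x. x < h \<and> cell t \<eta> (Y x G) = z})
      - real (card {y. h \<le> y \<and> y < n \<and> cell t \<eta> (Y y G) = z})\<bar>" for z
    have "h \<le> n" by (simp add: h_def)
    have W: "W z \<le> D + 1" if "z \<in> cells t m" for z
    proof -
      have "(\<Sum>j<n. X z j G) = (\<Sum>j\<in>{..<h} \<union> {h..<n}. X z j G)"
        using \<open>h \<le> n\<close> by (intro sum.cong) auto
      also have "\<dots> = (\<Sum>j<h. X z j G) + (\<Sum>j\<in>{h..<n}. X z j G)"
        by (rule sum.union_disjoint) auto
      also have "(\<Sum>j<h. X z j G) = real (card {x. x < h \<and> cell t \<eta> (Y x G) = z})"
      proof -
        have "(\<Sum>j<h. X z j G) = (\<Sum>j\<in>{x \<in> {..<h}. cell t \<eta> (Y x G) = z}. 1)"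
          unfolding sum.inter_filter[OF finite_lessThan] by (intro sum.cong) (auto simp: X_def s_def flip_def)
        then show ?thesis by simp
      qed
      also have "(\<Sum>j\<in>{h..<n}. X z j G) = - real (card {y. h \<le> y \<and> y < n \<and> cell t \<eta> (Y y G) = z})"
      proof -
        have "(\<Sum>j\<in>{h..<n}. X z j G) = (\<Sum>j\<in>{x \<in> {h..<n}. cell t \<eta> (Y x G) = z}. - 1)"
          unfolding sum.inter_filter[OF finite_atLeastLessThan] by (intro sum.cong) (auto simp: X_def s_def flip_def)
        then show ?thesis by (simp add: conj_assoc)
      qed
      finally have "W z = \<bar>\<Sum>j<n. X z j G\<bar>" by (simp add: W_def)
      moreover have "\<bar>(\<Sum>j<n. X z j G) - (\<Sum>j<n. expectation (X z j))\<bar> < D"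
        using nB that G unfolding B_def by auto
      ultimately show ?thesis using EX[of z] by linarith
    qed
    have "(\<Sum>z\<in>cells t m. W z + 1) \<le> (\<Sum>z\<in>cells t m. D + 2)"
      by (intro sum_mono) (use W in fastforce)
    then have "(\<Sum>z\<in>cells t m. W z + 1) \<le> card (cells t m) * (D + 2)" by simp
    moreover have "(\<Sum>j<n. cut_norm t (Y j G)) > n * (1 - 1 / t) - D"
      using nB G unfolding B0_def by auto
    moreover have "opt_max_tsp (euclid_dist t) (JL_image t n G)
      \<ge> 2 * (\<Sum>j<n. cut_norm t (Y j G)) - \<delta> * n - 4 * (\<Sum>z\<in>cells t m. W z + 1) - 4"
      using opt_max_tsp_JL_ge[OF t \<delta> m \<open>h \<le> n\<close> inj] unfolding W_def Y_def s_def \<eta>_def .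
    ultimately have "r \<le> opt_max_tsp (euclid_dist t) (JL_image t n G)" using r by argo
    then show "G \<in> E" using G by (simp add: E_def)
  qed
  have "AE G in ?M. G \<in> E \<or> G \<in> B0 \<union> (\<Union>z\<in>cells t m. B z)"
    using AE_inj_on_JL_col[OF t, of n] AE_space by eventually_elim (use cover in blast)
  then have "prob E \<ge> 1 - prob (B0 \<union> (\<Union>z\<in>cells t m. B z))"
    by (intro prob_ge_of_AE_cover sets.Un sets.finite_UN events finite_cells)
      (simp add: E_def sets_opt_max_tsp_JL)
  moreover have "prob (B0 \<union> (\<Union>z\<in>cells t m. B z)) \<le> prob B0 + (\<Sum>z\<in>cells t m. prob (B z))"
    using events finite_cells
    by (intro order_trans[OF measure_Un_le] add_left_mono finite_measure_subadditive_finite) auto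
  moreover have "(\<Sum>z\<in>cells t m. prob (B z)) \<le> (\<Sum>z\<in>cells t m. 2 * exp (- D\<^sup>2 / (2 * n)))"
    by (intro sum_mono B)
  ultimately show ?thesis using B0 unfolding E_def by (simp add: algebra_simps)
qed

section \<open>Choice of parameters for \<epsilon> below 9/10\<close>

text \<open>\<open>N\<close> will be \<open>ln n\<close>, so there are at most n^(1/16) cells. The
  weight q = 1 / (1 + \<epsilon>) makes (1/q)^m at most exp (3t), while the other factor is at most
  (4/\<epsilon>)^t.\<close>

lemma card_cells_le_exp:
  assumes \<epsilon>: "0 < \<epsilon>" "\<epsilon> < 1" and L: "ln (1 / \<epsilon>) \<ge> 1 / 10"
    and N: "1000 * real t * ln (1 / \<epsilon>) \<le> N" and m: "real m \<le> real t * (2 / \<epsilon> + 1)"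
  shows "real (card (cells t m)) \<le> exp (N / 16)"
proof -
  define L where "L = ln (1 / \<epsilon>)"
  have "real (card (cells t m)) \<le> (1 / (1 / (1 + \<epsilon>))) ^ m * (2 / (1 - 1 / (1 + \<epsilon>))) ^ t"
    using \<epsilon> by (intro card_cells_le) (auto simp: field_simps)
  also have "\<dots> \<le> exp (3 * real t) * exp ((2 + L) * real t)"
  proof (rule mult_mono)
    have "(1 / (1 / (1 + \<epsilon>))) ^ m \<le> exp \<epsilon> ^ m" using \<epsilon> by (intro power_mono) auto
    also have "\<dots> = exp (real m * \<epsilon>)" by (simp add: exp_of_nat_mult)
    also have "\<dots> \<le> exp (3 * real t)"
    proof -
      have "real m * \<epsilon> \<le> real t * (2 / \<epsilon> + 1) * \<epsilon>" using m \<epsilon> by (intro mult_right_mono) auto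
      also have "\<dots> = real t * (2 + \<epsilon>)" using \<epsilon> by (simp add: field_simps)
      also have "\<dots> \<le> real t * 3" using \<epsilon> by (intro mult_left_mono) auto
      finally show ?thesis by simp
    qed
    finally show "(1 / (1 / (1 + \<epsilon>))) ^ m \<le> exp (3 * real t)" .
    have "2 / (1 - 1 / (1 + \<epsilon>)) = 2 * (1 + \<epsilon>) / \<epsilon>" using \<epsilon> by (simp add: field_simps)
    also have "\<dots> \<le> 4 * (1 / \<epsilon>)" using \<epsilon> by (simp add: field_simps)
    also have "\<dots> \<le> exp 2 * exp L"
    proof (rule mult_mono)
      have "4 \<le> (1 + 1 :: real)\<^sup>2" by simp
      also have "\<dots> \<le> (exp 1)\<^sup>2" using exp_ge_add_one_self[of 1] by (intro power_mono) auto
      also have "\<dots> = exp 2" by (simp add: exp_of_nat_mult[symmetric])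
      finally show "4 \<le> exp (2 :: real)" .
    qed (use \<epsilon> in \<open>auto simp: L_def exp_ln\<close>)
    finally have "2 / (1 - 1 / (1 + \<epsilon>)) \<le> exp (2 + L)" by (simp add: exp_add)
    then have "(2 / (1 - 1 / (1 + \<epsilon>))) ^ t \<le> exp (2 + L) ^ t"
      using \<epsilon> by (intro power_mono) (auto simp: field_simps)
    then show "(2 / (1 - 1 / (1 + \<epsilon>))) ^ t \<le> exp ((2 + L) * real t)"
      by (simp add: exp_of_nat_mult[symmetric] mult.commute)
    show "0 \<le> (2 / (1 - 1 / (1 + \<epsilon>))) ^ t" using \<epsilon> by (intro zero_le_power) (auto simp: field_simps)
  qed simp
  also have "\<dots> = exp ((5 + L) * real t)" by (simp add: exp_add[symmetric] algebra_simps)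
  also have "\<dots> \<le> exp (N / 16)"
  proof -
    \<comment> \<open>\<open>L\<close> is at least 1/10, so 5 <= 50 L; and 16 * 51 <= 1000.\<close>
    have "(5 + L) * real t \<le> (51 * L) * real t" using L by (intro mult_right_mono) (auto simp: L_def)
    moreover have "0 \<le> L * real t" using L by (simp add: L_def)
    ultimately have "16 * ((5 + L) * real t) \<le> 1000 * real t * L" by (simp add: algebra_simps)
    then have "(5 + L) * real t \<le> N / 16" using N unfolding L_def by linarith
    then show ?thesis by simp
  qed
  finally show ?thesis .
qed

text \<open>The slack of 7/5 \<epsilon> n is split: \<epsilon> n for the cell diameter, which is set
  to \<epsilon>, and 2/5 \<epsilon> n for the deficit of the mean norm, the deviations and the
  jumps.\<close>

lemma prob_JL_small_eps:
  fixes \<epsilon> :: real and n t :: nat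
  assumes \<epsilon>: "0 < \<epsilon>" "\<epsilon> < 9 / 10" and n: "n > 0"
    and t_ge: "1000 * ln (1 / \<epsilon>) / \<epsilon> ^ 2 \<le> real t"
    and t_le: "real t \<le> ln (real n) / (1000 * ln (1 / \<epsilon>))"
    and r: "r \<le> (2 - 7 / 5 * \<epsilon>) * n"
  shows "measure (gauss_JL t n) {G \<in> space (gauss_JL t n). r \<le> opt_max_tsp (euclid_dist t) (JL_image t n G)}
    \<ge> 1 - real n powr (- 25)"
proof -
  define N where "N = ln (real n)"
  \<comment> \<open>D = n^(3/4) and K = n^(1/16): K D = n^(13/16) is small against n, while D^2 / n
    = n^(1/2) makes the tails smaller than the required power of n.\<close>
  define D where "D = exp (3 / 4 * N)"
  define K where "K = exp (N / 16)"
  define m where "m = nat \<lfloor>real t * (2 / \<epsilon> + 1)\<rfloor>"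
  have nN: "real n = exp N" using n by (simp add: N_def)
  \<comment> \<open>This is where \<epsilon> < 9/10 enters: it keeps ln (1/\<epsilon>) away from
    0.\<close>
  have "ln \<epsilon> \<le> \<epsilon> - 1" using \<epsilon> by (intro ln_le_minus_one) auto
  then have L: "ln (1 / \<epsilon>) \<ge> 1 / 10" using \<epsilon> by (simp add: ln_div)
  have "100 / \<epsilon>\<^sup>2 \<le> 1000 * ln (1 / \<epsilon>) / \<epsilon> ^ 2" using L by (intro divide_right_mono) auto
  then have t100: "100 / \<epsilon>\<^sup>2 \<le> real t" using t_ge by linarith
  then have t\<epsilon>: "100 \<le> real t * \<epsilon>\<^sup>2" using \<epsilon> by (simp add: divide_le_eq)
  then have t: "t > 0" by (cases "t = 0") auto
  have N1: "1000 * real t * ln (1 / \<epsilon>) \<le> N"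
    using t_le L unfolding N_def by (simp add: le_divide_eq mult_ac)
  have "1000 * real t * (1 / 10) \<le> 1000 * real t * ln (1 / \<epsilon>)" using L by (intro mult_left_mono) auto
  then have Nt: "N \<ge> 100 * real t" using N1 by simp
  then have "N * \<epsilon>\<^sup>2 \<ge> 100 * real t * \<epsilon>\<^sup>2" by (intro mult_right_mono) auto
  then have N\<epsilon>: "N * \<epsilon>\<^sup>2 \<ge> 10000" using t\<epsilon> by simp
  have "\<epsilon>\<^sup>2 \<le> 1" using \<epsilon> by (simp add: power_le_one)
  moreover have "N \<ge> 0" using Nt by (rule order_trans[rotated]) simp
  ultimately have "N * \<epsilon>\<^sup>2 \<le> N" by (simp add: mult_left_le)
  then have N: "N \<ge> 10000" using N\<epsilon> by simp
  have mle: "real m \<le> real t * (2 / \<epsilon> + 1)" and mge: "real t * (2 / \<epsilon> + 1) \<le> real m + 1"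
  proof -
    have "0 \<le> real t * (2 / \<epsilon> + 1)" using \<epsilon> by simp
    then show "real m \<le> real t * (2 / \<epsilon> + 1)" "real t * (2 / \<epsilon> + 1) \<le> real m + 1"
      unfolding m_def by linarith+
  qed
  have card: "real (card (cells t m)) \<le> K"
    unfolding K_def by (rule card_cells_le_exp[OF _ _ L N1 mle]) (use \<epsilon> in auto)
  have K1: "K \<ge> 1" and D1: "D \<ge> 1" unfolding K_def D_def using N by auto
  have bound: "r \<le> 2 * (n * (1 - 1 / t) - D) - \<epsilon> * n - 4 * (card (cells t m) * (D + 2)) - 4"
  proof -
    have "card (cells t m) * (D + 2) \<le> K * (D + 2)" using card D1 by (intro mult_right_mono) auto
    also have "\<dots> \<le> 3 * (K * D)"
      using mult_left_mono[OF D1, of "K"] K1 by (simp add: algebra_simps)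
    finally have "4 * (card (cells t m) * (D + 2)) \<le> 12 * (K * D)" by linarith
    moreover have "D \<le> K * D" "1 \<le> K * D"
      using K1 D1 mult_mono[of 1 K 1 D] mult_right_mono[OF K1, of D] by auto
    ultimately have 1: "2 * D + 4 * (card (cells t m) * (D + 2)) + 4 \<le> 18 * (K * D)" by linarith
    \<comment> \<open>The quotient n / (K D) = exp (3N/16) exceeds 3N/16, and N \<epsilon>^2 >=
      10000, so K D is a small multiple of n \<epsilon>^2.\<close>
    have "K * D * (1 + 3 / 16 * N) \<le> K * D * exp (3 / 16 * N)"
      using exp_ge_add_one_self[of "3 / 16 * N"] K1 D1 by (intro mult_left_mono) auto
    also have "\<dots> = n" unfolding nN K_def D_def by (simp add: exp_add[symmetric])
    finally have KDN: "K * D * N \<le> 16 / 3 * n" using \<open>1 \<le> K * D\<close> by (simp add: algebra_simps)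
    have "10000 * (K * D) \<le> (N * \<epsilon>\<^sup>2) * (K * D)" using N\<epsilon> \<open>1 \<le> K * D\<close> by (intro mult_right_mono) auto
    also have "\<dots> = (K * D * N) * \<epsilon>\<^sup>2" by simp
    also have "\<dots> \<le> (16 / 3 * n) * \<epsilon>\<^sup>2" using KDN by (intro mult_right_mono) auto
    finally have KD: "10000 * (K * D) \<le> 16 / 3 * (n * \<epsilon>\<^sup>2)" by simp
    have "1 / real t \<le> \<epsilon>\<^sup>2 / 100" using t\<epsilon> t by (simp add: field_simps)
    then have "n * (1 / real t) \<le> n * (\<epsilon>\<^sup>2 / 100)" by (intro mult_left_mono) auto
    then have 2: "2 * (n / real t) \<le> n * \<epsilon>\<^sup>2 / 50" by (simp add: mult.commute)
    have "\<epsilon>\<^sup>2 \<le> \<epsilon>" using \<epsilon> by (simp add: power2_eq_square mult_left_le)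
    then have "n * \<epsilon>\<^sup>2 \<le> n * \<epsilon>" by (intro mult_left_mono) auto
    moreover have "0 \<le> n * \<epsilon>\<^sup>2" by simp
    ultimately have "2 * (n / real t) + 18 * (K * D) \<le> 2 / 5 * (n * \<epsilon>)" using 2 KD by linarith
    moreover have "2 * (n * (1 - 1 / t)) = 2 * real n - 2 * (n / real t)" by (simp add: algebra_simps)
    ultimately have "(2 - 7 / 5 * \<epsilon>) * n \<le> 2 * (n * (1 - 1 / t) - D) - \<epsilon> * n - 4 * (card (cells t m) * (D + 2)) - 4"
      using 1 by (simp add: algebra_simps)
    then show ?thesis using r by linarith
  qed
  have "(2 * card (cells t m) + 1) * exp (- D\<^sup>2 / (2 * n)) \<le> (3 * K) * exp (- exp (N / 2) / 2)"
  proof (rule mult_mono)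
    have "D\<^sup>2 = exp (3 / 2 * N)" by (simp add: D_def exp_of_nat_mult[symmetric])
    then have "D\<^sup>2 = exp (N / 2) * real n" by (simp add: nN exp_add[symmetric])
    then show "exp (- D\<^sup>2 / (2 * n)) \<le> exp (- exp (N / 2) / 2)" using n by simp
  qed (use card K1 in auto)
  also have "\<dots> \<le> exp 2 * K * exp (- exp (N / 2) / 2)"
    using exp_ge_add_one_self[of 2] K1 by (intro mult_right_mono) auto
  also have "\<dots> = exp (2 + N / 16 - exp (N / 2) / 2)" by (simp add: K_def exp_add[symmetric] exp_diff exp_minus field_simps)
  also have "\<dots> \<le> exp (- 25 * N)"
  proof -
    have "N / 4 \<le> exp (N / 4)" using exp_ge_add_one_self[of "N / 4"] by linarith
    then have "(N / 4)\<^sup>2 \<le> (exp (N / 4))\<^sup>2" using N by (intro power_mono) auto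
    also have "\<dots> = exp (N / 2)" by (simp add: exp_of_nat_mult[symmetric])
    finally have "N * N / 16 \<le> exp (N / 2)" by (simp add: power2_eq_square)
    moreover have "10000 * N \<le> N * N" using N by (intro mult_right_mono) auto
    ultimately have "2 + N / 16 - exp (N / 2) / 2 \<le> - 25 * N" using N by linarith
    then show ?thesis by simp
  qed
  also have "\<dots> = real n powr (- 25)" using n by (simp add: powr_def N_def)
  finally have "(2 * card (cells t m) + 1) * exp (- D\<^sup>2 / (2 * n)) \<le> real n powr (- 25)" .
  moreover have "measure (gauss_JL t n) {G \<in> space (gauss_JL t n). r \<le> opt_max_tsp (euclid_dist t) (JL_image t n G)}
    \<ge> 1 - (2 * card (cells t m) + 1) * exp (- D\<^sup>2 / (2 * n))"
    by (rule prob_opt_max_tsp_JL_ge[OF t n \<epsilon>(1) mge _ bound]) (use D1 in simp)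
  ultimately show ?thesis by linarith
qed

section \<open>The tour in the given order, for \<epsilon> of at least 9/10\<close>

text \<open>Applied to the edges of a path, this yields two families in which no two edges share an
  endpoint.\<close>

lemma sum_even_odd:
  fixes g :: "nat \<Rightarrow> real"
  shows "(\<Sum>i<k. g i) = (\<Sum>i<(k + 1) div 2. g (2 * i)) + (\<Sum>i<k div 2. g (2 * i + 1))"
proof (induction k)
  case (Suc k)
  show ?case
  proof (cases "even k")
    case True
    then obtain l where "k = 2 * l" by blast
    then show ?thesis using Suc by simp
  next
    case False
    then obtain l where "k = 2 * l + 1" using oddE by blast
    then show ?thesis using Suc by simp
  qed
qed simp

text \<open>Disjoint pairs of columns have independent distances. Truncated at 3 these have mean at
  least 4/5, so a deviation of 1/20 per pair is left, and 2 (1/20)^2 / 3^2 = 1/1800.\<close>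

lemma prob_disjoint_dists_le:
  assumes t: "t > 0" and p: "p > 0"
    and ab: "\<And>k. k < p \<Longrightarrow> a k < n \<and> b k < n \<and> a k \<noteq> b k"
    and disj: "\<And>k l. k < p \<Longrightarrow> l < p \<Longrightarrow> k \<noteq> l \<Longrightarrow> {a k, b k} \<inter> {a l, b l} = {}"
  shows "{G \<in> space (gauss_JL t n). (\<Sum>k<p. euclid_dist t (JL_col t G (a k)) (JL_col t G (b k))) \<le> 3 / 4 * p}
    \<in> sets (gauss_JL t n)"
    and "measure (gauss_JL t n)
      {G \<in> space (gauss_JL t n). (\<Sum>k<p. euclid_dist t (JL_col t G (a k)) (JL_col t G (b k))) \<le> 3 / 4 * p}
      \<le> exp (- real p / 1800)"
proof -
  interpret prob_space "gauss_JL t n" by (rule prob_space_gauss_JL[OF t])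
  define d where "d k G = euclid_dist t (JL_col t G (a k)) (JL_col t G (b k))" for k G
  define X where "X k G = min 3 (d k G)" for k G
  have dm: "d k \<in> borel_measurable (gauss_JL t n)" if "k < p" for k
    unfolding d_def using measurable_dist ab that by blast
  then have S: "(\<lambda>G. \<Sum>k<p. d k G) \<in> borel_measurable (gauss_JL t n)"
    by (intro borel_measurable_sum) auto
  then show "{G \<in> space (gauss_JL t n). (\<Sum>k<p. euclid_dist t (JL_col t G (a k)) (JL_col t G (b k))) \<le> 3 / 4 * p}
    \<in> sets (gauss_JL t n)"
    unfolding d_def by measurable
  let ?K = "\<lambda>k. {a k, b k}"
  have "indep_vars (\<lambda>k. PiM (?K k) (\<lambda>_. vecM t)) (\<lambda>k G. restrict (\<lambda>j. column t 1 j G) (?K k)) {..<p}"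
    by (rule indep_vars_restrict[OF indep_columns[OF t, of n "\<lambda>_. 1"]])
      (use ab disj in \<open>auto simp: disjoint_family_on_def\<close>)
  then have "indep_vars (\<lambda>_. borel) (\<lambda>k G. min 3 (sqrt (\<Sum>i<t. (restrict (\<lambda>j. column t 1 j G) (?K k) (a k) i
      - restrict (\<lambda>j. column t 1 j G) (?K k) (b k) i)\<^sup>2))) {..<p}"
  proof (rule indep_vars_compose2)
    fix k assume "k \<in> {..<p}"
    have "(\<lambda>w. w j i) \<in> borel_measurable (PiM (?K k) (\<lambda>_. vecM t))" if "j \<in> ?K k" "i < t" for i j
      by (rule measurable_compose[OF measurable_component_singleton[OF that(1)] measurable_component_singleton])
        (use that in auto)
    then show "(\<lambda>w. min 3 (sqrt (\<Sum>i<t. (w (a k) i - w (b k) i)\<^sup>2))) \<in> borel_measurable (PiM (?K k) (\<lambda>_. vecM t))"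
      by (intro borel_measurable_min borel_measurable_const measurable_compose[OF _ borel_measurable_sqrt]
          borel_measurable_sum borel_measurable_power borel_measurable_diff) auto
  qed
  also have "(\<lambda>k G. min 3 (sqrt (\<Sum>i<t. (restrict (\<lambda>j. column t 1 j G) (?K k) (a k) i
      - restrict (\<lambda>j. column t 1 j G) (?K k) (b k) i)\<^sup>2))) = X"
    unfolding X_def d_def euclid_dist_JL_col
    by (intro ext arg_cong2[of _ _ _ _ min] arg_cong[of _ _ sqrt] sum.cong refl) (auto simp: column_def)
  finally have ind: "indep_vars (\<lambda>_. borel) X {..<p}" .
  have "(\<Sum>k<p. 4 / 5) \<le> (\<Sum>k<p. expectation (X k))"
    unfolding X_def d_def using ab by (intro sum_mono expectation_dist_ge[OF t]) auto
  then have E: "4 / 5 * p \<le> (\<Sum>k<p. expectation (X k))" by simp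
  have X: "0 \<le> X k G \<and> X k G \<le> 3" for k G by (simp add: X_def d_def euclid_dist_nonneg)
  have Xm: "X k \<in> borel_measurable (gauss_JL t n)" if "k < p" for k
    unfolding X_def[abs_def] using dm[OF that] by (intro borel_measurable_min) auto
  have "prob {G \<in> space (gauss_JL t n). (\<Sum>k<p. d k G) \<le> 3 / 4 * p}
      \<le> prob {G \<in> space (gauss_JL t n). (\<Sum>k<p. X k G) \<le> 4 / 5 * p - p / 20}"
  proof (rule finite_measure_mono)
    have le: "(\<Sum>k<p. X k G) \<le> (\<Sum>k<p. d k G)" for G by (intro sum_mono) (simp add: X_def)
    show "{G \<in> space (gauss_JL t n). (\<Sum>k<p. d k G) \<le> 3 / 4 * p}
      \<subseteq> {G \<in> space (gauss_JL t n). (\<Sum>k<p. X k G) \<le> 4 / 5 * p - p / 20}"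
    proof (intro Collect_mono impI, elim conjE, intro conjI)
      fix G assume "(\<Sum>k<p. d k G) \<le> 3 / 4 * p"
      then show "(\<Sum>k<p. X k G) \<le> 4 / 5 * p - p / 20" using le[of G] by linarith
    qed
    have "(\<lambda>G. \<Sum>k<p. X k G) \<in> borel_measurable (gauss_JL t n)"
      using Xm by (intro borel_measurable_sum) auto
    then show "{G \<in> space (gauss_JL t n). (\<Sum>k<p. X k G) \<le> 4 / 5 * p - p / 20} \<in> events" by measurable
  qed
  also have "\<dots> \<le> exp (- 2 * (p / 20)\<^sup>2 / (real (card {..<p}) * (3 - 0)\<^sup>2))"
    by (rule Hoeffding_bounded(1)[OF _ _ ind X _ _ E]) (use p in auto)
  also have "- 2 * (real p / 20)\<^sup>2 / (real (card {..<p}) * (3 - 0)\<^sup>2) = - real p / 1800"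
    using p by (simp add: field_simps power2_eq_square)
  finally show "prob {G \<in> space (gauss_JL t n). (\<Sum>k<p. euclid_dist t (JL_col t G (a k)) (JL_col t G (b k))) \<le> 3 / 4 * p}
      \<le> exp (- real p / 1800)" by (simp add: d_def)
qed

text \<open>n - 1 edges of average length above 3/4 suffice. The constant is 37/50 = 2 - 7/5 *
  9/10.\<close>

lemma prob_JL_large_eps:
  fixes n t :: nat and r :: real
  assumes t: "t > 0" and n: "n \<ge> 10000" and r: "r \<le> 37 / 50 * n"
  shows "measure (gauss_JL t n) {G \<in> space (gauss_JL t n). r \<le> opt_max_tsp (euclid_dist t) (JL_image t n G)}
    \<ge> 1 - exp (- real n / 7200)"
proof -
  interpret prob_space "gauss_JL t n" by (rule prob_space_gauss_JL[OF t])
  let ?M = "gauss_JL t n"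
  define d where "d a b G = euclid_dist t (JL_col t G a) (JL_col t G b)" for a b G
  define E where "E = {G \<in> space ?M. r \<le> opt_max_tsp (euclid_dist t) (JL_image t n G)}"
  \<comment> \<open>\<open>p\<close> edges of the path start at an even position and
    \<open>q\<close> at an odd one.\<close>
  define p where "p = n div 2"
  define q where "q = (n - 1) div 2"
  define B1 where "B1 = {G \<in> space ?M. (\<Sum>k<p. d (2 * k) (Suc (2 * k)) G) \<le> 3 / 4 * p}"
  define B2 where "B2 = {G \<in> space ?M. (\<Sum>k<q. d (Suc (2 * k)) (Suc (Suc (2 * k))) G) \<le> 3 / 4 * q}"
  have p: "p > 0" "\<And>k. k < p \<Longrightarrow> Suc (2 * k) < n" using n by (auto simp: p_def)
  have q: "q > 0" "\<And>k. k < q \<Longrightarrow> Suc (Suc (2 * k)) < n" using n by (auto simp: q_def)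
  have B1: "B1 \<in> events" "prob B1 \<le> exp (- real p / 1800)"
    unfolding B1_def d_def
    by (rule prob_disjoint_dists_le[OF t p(1)]; use p in \<open>force dest: arg_cong[of _ _ even]\<close>)+
  have B2: "B2 \<in> events" "prob B2 \<le> exp (- real q / 1800)"
    unfolding B2_def d_def
    by (rule prob_disjoint_dists_le[OF t q(1)]; use q in \<open>force dest: arg_cong[of _ _ even]\<close>)+
  have pq: "p + q = n - 1" by (simp add: p_def q_def)
  have cover: "G \<in> E" if G: "G \<in> space ?M" "inj_on (JL_col t G) {..<n}" "G \<notin> B1 \<union> B2" for G
  proof -
    have "3 / 4 * p < (\<Sum>k<p. d (2 * k) (Suc (2 * k)) G)"
      "3 / 4 * q < (\<Sum>k<q. d (Suc (2 * k)) (Suc (Suc (2 * k))) G)"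
      using G by (auto simp: B1_def B2_def)
    moreover have "(\<Sum>k<n - 1. d k (Suc k) G)
        = (\<Sum>k<p. d (2 * k) (Suc (2 * k)) G) + (\<Sum>k<q. d (Suc (2 * k)) (Suc (Suc (2 * k))) G)"
      using sum_even_odd[of "\<lambda>k. d k (Suc k) G" "n - 1"] n by (simp add: p_def q_def)
    moreover have "(\<Sum>k<n - 1. d k (Suc k) G) = path_cost (\<lambda>a b. d a b G) [0..<n]"
      unfolding path_cost_eq_sum by (intro sum.cong) auto
    moreover have "path_cost (\<lambda>a b. d a b G) [0..<n] \<le> opt_max_tsp (euclid_dist t) (JL_image t n G)"
      unfolding d_def by (rule opt_max_tsp_JL_ge_path_cost[OF G(2)]) auto
    moreover have "3 / 4 * real p + 3 / 4 * real q \<ge> r"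
    proof -
      have "real p + real q = real n - 1" using pq n by linarith
      then show ?thesis using r n by linarith
    qed
    ultimately show ?thesis using G(1) unfolding E_def by simp
  qed
  have "AE G in ?M. G \<in> E \<or> G \<in> B1 \<union> B2"
    using AE_inj_on_JL_col[OF t, of n] AE_space by eventually_elim (use cover in blast)
  then have "prob E \<ge> 1 - prob (B1 \<union> B2)"
    using B1 B2 by (intro prob_ge_of_AE_cover) (auto simp: E_def sets_opt_max_tsp_JL)
  moreover have "prob (B1 \<union> B2) \<le> prob B1 + prob B2" using B1 B2 by (intro measure_Un_le) auto
  \<comment> \<open>Halving the rate 1/3600 to 1/7200 frees a factor exp (-1), which absorbs the 2
    of the union bound.\<close>
  moreover have "exp (- real p / 1800) \<le> exp (- 1 - real n / 7200)" "exp (- real q / 1800) \<le> exp (- 1 - real n / 7200)"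
  proof -
    have "real p \<ge> real n / 2 - 1" "real q \<ge> real n / 2 - 1" unfolding p_def q_def by linarith+
    then show "exp (- real p / 1800) \<le> exp (- 1 - real n / 7200)" "exp (- real q / 1800) \<le> exp (- 1 - real n / 7200)"
      using n by auto
  qed
  moreover have "2 * exp (- 1 - real n / 7200) \<le> exp (- real n / 7200)"
  proof -
    have "exp (- 1 - real n / 7200) * exp 1 = exp (- real n / 7200)" by (simp add: exp_add[symmetric])
    moreover have "exp (- 1 - real n / 7200) * 2 \<le> exp (- 1 - real n / 7200) * exp 1"
      using exp_ge_add_one_self[of 1] by (intro mult_left_mono) auto
    ultimately show ?thesis by linarith
  qed
  ultimately show ?thesis using B1 B2 unfolding E_def by linarith
qed

section \<open>Combination of the two ranges of \<epsilon>\<close>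

theorem mainTheorem5:
  "\<exists>C c c0 :: real. C > 0 \<and> c > 0 \<and> c0 > 0 \<and>
    (\<forall>(\<epsilon>::real) (n::nat) (t::nat).
       0 < \<epsilon> \<and> \<epsilon> < 1 \<and> real n \<ge> c0 / \<epsilon> ^ 3 \<and>
       C * ln (1 / \<epsilon>) / \<epsilon> ^ 2 \<le> real t \<and>
       real t \<le> ln (real n) / (C * ln (1 / \<epsilon>)) \<longrightarrow>
       measure (gauss_JL t n)
         {G \<in> space (gauss_JL t n).
            opt_max_tsp (euclid_dist t) (JL_image t n G)
              \<ge> (sqrt 2 - \<epsilon>) * opt_max_tsp (euclid_dist n) (std_basis n)}
       \<ge> 1 - exp (- c * real n * \<epsilon> ^ 3) - real n powr (-25))"
proof (rule exI[of _ 1000], rule exI[of _ "1 / 7200"], rule exI[of _ 10000], intro conjI allI impI)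
  fix \<epsilon> :: real and n t :: nat
  assume *: "0 < \<epsilon> \<and> \<epsilon> < 1 \<and> real n \<ge> 10000 / \<epsilon> ^ 3 \<and>
       1000 * ln (1 / \<epsilon>) / \<epsilon> ^ 2 \<le> real t \<and> real t \<le> ln (real n) / (1000 * ln (1 / \<epsilon>))"
  then have \<epsilon>: "0 < \<epsilon>" "\<epsilon> < 1" by auto
  define r where "r = (sqrt 2 - \<epsilon>) * opt_max_tsp (euclid_dist n) (std_basis n)"
  have sqrt2: "sqrt 2 \<ge> 7 / 5" by (rule real_le_rsqrt) (simp add: power2_eq_square)
  have "r \<le> (sqrt 2 - \<epsilon>) * (n * sqrt 2)"
    unfolding r_def using opt_max_tsp_std_basis_le[of n] sqrt2 \<epsilon> by (intro mult_left_mono) auto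
  also have "\<dots> = (2 - sqrt 2 * \<epsilon>) * n" by (simp add: algebra_simps)
  also have "\<dots> \<le> (2 - 7 / 5 * \<epsilon>) * n" using sqrt2 \<epsilon> by (intro mult_right_mono) auto
  finally have r: "r \<le> (2 - 7 / 5 * \<epsilon>) * n" .
  have \<epsilon>3: "\<epsilon> ^ 3 \<le> 1" "0 < \<epsilon> ^ 3" using \<epsilon> by (auto simp: power_le_one)
  then have "10000 \<le> 10000 / \<epsilon> ^ 3" by (simp add: le_divide_eq)
  then have n: "n \<ge> 10000" using * by linarith
  have "1 - exp (- (1 / 7200) * real n * \<epsilon> ^ 3) - real n powr (-25)
      \<le> measure (gauss_JL t n) {G \<in> space (gauss_JL t n). r \<le> opt_max_tsp (euclid_dist t) (JL_image t n G)}"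
  \<comment> \<open>Below 9/10, ln (1/\<epsilon>) is at least 1/10; from 9/10 on, the target is at
    most 37/50 n. The failure probability is charged to \<open>n powr -25\<close> in the first case
    and to the exponential term in the second.\<close>
  proof (cases "\<epsilon> < 9 / 10")
    case True
    have "1 - real n powr (-25)
        \<le> measure (gauss_JL t n) {G \<in> space (gauss_JL t n). r \<le> opt_max_tsp (euclid_dist t) (JL_image t n G)}"
      by (rule prob_JL_small_eps[OF \<epsilon>(1) True _ _ _ r]) (use * n in auto)
    then show ?thesis by (smt (verit) exp_gt_zero)
  next
    case False
    \<comment> \<open>A positive logarithm makes the lower bound on \<open>t\<close> positive and so
      rules out \<open>t = 0\<close>.\<close>
    have "ln (1 / \<epsilon>) > 0" using \<epsilon> by simp
    then have "1000 * ln (1 / \<epsilon>) / \<epsilon> ^ 2 > 0" using \<epsilon> by simp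
    then have "real t > 0" using * by linarith
    then have t: "t > 0" by simp
    have "(2 - 7 / 5 * \<epsilon>) * n \<le> 37 / 50 * n" using False by (intro mult_right_mono) auto
    then have "1 - exp (- real n / 7200)
        \<le> measure (gauss_JL t n) {G \<in> space (gauss_JL t n). r \<le> opt_max_tsp (euclid_dist t) (JL_image t n G)}"
      using r by (intro prob_JL_large_eps t n) auto
    moreover have "exp (- real n / 7200) \<le> exp (- (1 / 7200) * real n * \<epsilon> ^ 3)"
      using \<epsilon>3 by (simp add: mult_left_le)
    ultimately show ?thesis by (smt (verit) powr_ge_zero)
  qed
  then show "measure (gauss_JL t n)
         {G \<in> space (gauss_JL t n).
            opt_max_tsp (euclid_dist t) (JL_image t n G)
              \<ge> (sqrt 2 - \<epsilon>) * opt_max_tsp (euclid_dist n) (std_basis n)}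
       \<ge> 1 - exp (- (1 / 7200) * real n * \<epsilon> ^ 3) - real n powr (-25)"
    unfolding r_def .
qed auto

end
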